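(* Let $U_1<U_2$ be real numbers. Let $W$ be a Gaussian space-time white noise on $\mathbb{R}\times[0,1]$, let $$x(u)=\int_0^1\int_{\mathbb{R}}p_{1-s}(u-v)\,W(dv,ds),\qquad u\in[U_1,U_2],$$ where $p_t(u)=\frac{1}{\sqrt{2\pi t}}e^{-\frac{u^2}{2t}}$ for $t>0$, $u\in\mathbb{R}$, and let $x_{U_1}(u)=x(u)-x(U_1)$, $u\in[U_1,U_2]$. Then for every $p\in\mathbb{N}$ and every $z\in\mathbb{R}$ the limit $$L_p\text{-}\lim_{\varepsilon\to0+}\int_{U_1}^{U_2}p_\varepsilon\big(x_{U_1}(u)-z\big)\,du=:\int_{U_1}^{U_2}\delta_z\big(x_{U_1}(u)\big)\,du$$ exists; that is, the process $x_{U_1}$ has a local time at every point $z$ on $[U_1,U_2]$.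
   Context: A Gaussian space-time white noise (Brownian sheet) $W$ on $\mathbb{R}\times[0,1]$ is a centered Gaussian random measure with independent values on disjoint sets and intensity Lebesgue measure; equivalently, the family of stochastic integrals $\int_0^1\int_{\mathbb{R}} g(v,s)\,W(dv,ds)$, $g\in L_2(\mathbb{R}\times[0,1])$ (real), is a centered Gaussian family, linear in $g$, with $E\big(\int_0^1\int_{\mathbb{R}} g\,dW\big)^2=\int_0^1\int_{\mathbb{R}} g(v,s)^2\,dv\,ds$. The process $x(u)$ is the value at time $t=1$ of the solution to the stochastic heat equation $\partial_t x=\frac12\partial_u^2x+W$, $x(\cdot,0)=0$; it is taken in a continuous (in $u$) version. $L_p\text{-}\lim$ denotes the limit in $L_p$ of the underlying probability space. The local time of a one-dimensional process $y(t)$, $t\in[T_1,T_2]$, at the point $z$ is the limit $L_p\text{-}\lim_{\varepsilon\to0}\int_{T_1}^{T_2}p_\varepsilon(y(s)-z)\,ds$, denoted $\int_{T_1}^{T_2}\delta_z(y(s))\,ds$, whenever this limit exists. In $p_\varepsilon$ the letter $p$ denotes the Gaussian density above, unrelated to the exponent $p\in\mathbb{N}$. *)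

theory Defs
  imports "HOL-Probability.Probability"
begin

definition heat_kernel :: "real \<Rightarrow> real \<Rightarrow> real" where
  "heat_kernel t u = 1 / sqrt (2 * pi * t) * exp (- u\<^sup>2 / (2 * t))"

text \<open>Degenerate Gaussian variables (variance zero) are allowed.\<close>

definition centered_gaussian :: "'a measure \<Rightarrow> ('a \<Rightarrow> real) \<Rightarrow> bool" where
  "centered_gaussian M X \<longleftrightarrow>
     X \<in> borel_measurable M \<and>
     ((AE \<omega> in M. X \<omega> = 0) \<or>
      (\<exists>\<sigma>>0. distributed M lborel X (\<lambda>x. ennreal (normal_density 0 \<sigma> x))))"

definition centered_gaussian_family ::
    "'a measure \<Rightarrow> 'i set \<Rightarrow> ('i \<Rightarrow> 'a \<Rightarrow> real) \<Rightarrow> bool" where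
  "centered_gaussian_family M I X \<longleftrightarrow>
     (\<forall>J c. finite J \<and> J \<subseteq> I \<longrightarrow> centered_gaussian M (\<lambda>\<omega>. \<Sum>j\<in>J. c j * X j \<omega>))"

text \<open>Points of the strip are pairs \<open>(v, s)\<close> of a space variable \<open>v\<close> and a time variable \<open>s\<close>.\<close>

definition strip :: "(real \<times> real) measure" where
  "strip = restrict_space lborel (UNIV \<times> {0..1})"

definition L2_strip :: "(real \<times> real \<Rightarrow> real) set" where
  "L2_strip = {g. g \<in> borel_measurable strip \<and> integrable strip (\<lambda>z. (g z)\<^sup>2)}"

text \<open>
  White noise is given by its stochastic integrals: \<open>W g \<omega>\<close> is the integral of \<open>g\<close> against
  the noise. The index \<open>g\<close> is a function, not an equivalence class; linearity and the
  isometry make \<open>W f\<close> and \<open>W g\<close> almost surely equal when \<open>f = g\<close> almost everywhere on the strip.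
\<close>

definition space_time_white_noise ::
    "'a measure \<Rightarrow> ((real \<times> real \<Rightarrow> real) \<Rightarrow> 'a \<Rightarrow> real) \<Rightarrow> bool" where
  "space_time_white_noise M W \<longleftrightarrow>
     centered_gaussian_family M L2_strip W \<and>
     (\<forall>f\<in>L2_strip. \<forall>g\<in>L2_strip. \<forall>a b.
        AE \<omega> in M. W (\<lambda>z. a * f z + b * g z) \<omega> = a * W f \<omega> + b * W g \<omega>) \<and>
     (\<forall>g\<in>L2_strip. (\<integral>\<omega>. (W g \<omega>)\<^sup>2 \<partial>M) = (\<integral>z. (g z)\<^sup>2 \<partial>strip))"

text \<open>
  At \<open>s = 1\<close> the kernel has the junk value \<open>0\<close> (division by zero); this is a null set of the strip.
\<close>

definition heat_solution_version ::
    "'a measure \<Rightarrow> ((real \<times> real \<Rightarrow> real) \<Rightarrow> 'a \<Rightarrow> real) \<Rightarrow> real set \<Rightarrow>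
      (real \<Rightarrow> 'a \<Rightarrow> real) \<Rightarrow> bool" where
  "heat_solution_version M W T x \<longleftrightarrow>
     (\<forall>u\<in>T. x u \<in> borel_measurable M \<and>
        (AE \<omega> in M. x u \<omega> = W (\<lambda>(v, s). heat_kernel (1 - s) (u - v)) \<omega>)) \<and>
     (\<forall>\<omega>\<in>space M. continuous_on T (\<lambda>u. x u \<omega>))"

definition in_Lp :: "'a measure \<Rightarrow> nat \<Rightarrow> ('a \<Rightarrow> real) \<Rightarrow> bool" where
  "in_Lp M p X \<longleftrightarrow> X \<in> borel_measurable M \<and> integrable M (\<lambda>\<omega>. \<bar>X \<omega>\<bar> ^ p)"

definition Lp_norm :: "'a measure \<Rightarrow> nat \<Rightarrow> ('a \<Rightarrow> real) \<Rightarrow> real" where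
  "Lp_norm M p X = root p (\<integral>\<omega>. \<bar>X \<omega>\<bar> ^ p \<partial>M)"

definition has_Lp_limit ::
    "'a measure \<Rightarrow> nat \<Rightarrow> ('i \<Rightarrow> 'a \<Rightarrow> real) \<Rightarrow> ('a \<Rightarrow> real) \<Rightarrow> 'i filter \<Rightarrow> bool" where
  "has_Lp_limit M p X L F \<longleftrightarrow>
     in_Lp M p L \<and> (\<forall>\<^sub>F i in F. in_Lp M p (X i)) \<and>
     ((\<lambda>i. Lp_norm M p (\<lambda>\<omega>. X i \<omega> - L \<omega>)) \<longlongrightarrow> 0) F"

definition is_local_time ::
    "'a measure \<Rightarrow> nat \<Rightarrow> (real \<Rightarrow> 'a \<Rightarrow> real) \<Rightarrow> real \<Rightarrow> real \<Rightarrow> real \<Rightarrow> ('a \<Rightarrow> real) \<Rightarrow> bool" where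
  "is_local_time M p y T1 T2 z L \<longleftrightarrow>
     has_Lp_limit M p
       (\<lambda>\<epsilon> \<omega>. LINT s:{T1..T2}|lborel. heat_kernel \<epsilon> (y s \<omega> - z)) L (at_right 0)"

end

theory Submission
  imports Defs
begin

text \<open>
  The covariance of the solution at time 1 is \<open>K(\<bar>u - u'\<bar>)\<close> with \<open>K\<close> convex and
  \<open>K' \<le> -c < 0\<close> on \<open>[0, U2 - U1]\<close>. Hence increments over disjoint intervals are negatively
  correlated and the variance of a combination of increments \<open>\<Sum> \<mu>\<^sub>j \<Delta>\<^sub>j\<close> is at
  least \<open>c \<Sum> \<mu>\<^sub>j\<^sup>2 |I\<^sub>j|\<close>, as for Brownian motion.

  Write \<open>f = p\<^sub>\<epsilon>(\<cdot> - z) - p\<^sub>\<delta>(\<cdot> - z)\<close> as the Fourier integral of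
  \<open>w(\<xi>) = exp(-\<epsilon>\<xi>\<^sup>2/2) - exp(-\<delta>\<xi>\<^sup>2/2)\<close>. The \<open>n\<close>-th moment of the integral of
  \<open>f(Y\<^sub>s)\<close> is \<open>n!\<close> times an integral over ordered times, in which each factor contributes
  one frequency. Integrating out the times from right to left, and using the variance bound only at the
  very end, bounds the moment by iterated Gaussian integrals that converge because
  \<open>1 / sqrt (t - s)\<close> is integrable. Keeping the weight \<open>w\<close> of the rightmost time only,
  dominated convergence makes all even moments of the differences tend to 0.
\<close>

section \<open>The heat kernel and the covariance function\<close>

text \<open>Near \<open>z\<close> the difference of two sharp heat kernels is large and changes
  sign, so its smallness in the mean comes from cancellation. Hence absolute values are taken only
  after the expectation, when the oscillating factors have become a Gaussian characteristic
  function. There the variance bound leaves a sum of squares of partial sums of the frequencies, one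
  for each gap between consecutive times. Passing from frequencies to partial sums only takes
  translations, so the estimate splits into one factor per gap, and a gap of length \<open>r\<close>
  costs a multiple of \<open>1 / sqrt r\<close>. The moments bounded in this way have no absolute
  value under the integral and coincide with absolute moments only for even exponents; convergence
  in \<open>L_p\<close> is therefore drawn from the exponent \<open>2 * p\<close>.\<close>

lemma heat_kernel_eq_normal_density:
  "t > 0 \<Longrightarrow> heat_kernel t u = normal_density 0 (sqrt t) u"
  by (simp add: heat_kernel_def normal_density_def)

lemma heat_kernel_nonneg [simp]: "t \<ge> 0 \<Longrightarrow> 0 \<le> heat_kernel t u"
  by (simp add: heat_kernel_def)

lemma heat_kernel_le: "t > 0 \<Longrightarrow> heat_kernel t u \<le> 1 / sqrt (2 * pi * t)"
  by (simp add: heat_kernel_def divide_right_mono mult_left_le)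

lemma borel_measurable_heat_kernel [measurable (raw)]:
  "f \<in> borel_measurable N \<Longrightarrow> g \<in> borel_measurable N \<Longrightarrow>
    (\<lambda>x. heat_kernel (f x) (g x)) \<in> borel_measurable N"
  unfolding heat_kernel_def by (intro borel_measurable_times borel_measurable_divide borel_measurable_exp borel_measurable_uminus
      borel_measurable_power borel_measurable_const measurable_compose[OF _ borel_measurable_sqrt]) auto

lemma continuous_on_heat_kernel [continuous_intros]:
  "continuous_on S f \<Longrightarrow> continuous_on S (\<lambda>x. heat_kernel t (f x))"
  unfolding heat_kernel_def divide_inverse by (intro continuous_intros)

section \<open>Fourier representation of the heat kernel\<close>

lemma integrable_gaussian_cis:
  fixes \<epsilon> x :: real
  assumes "\<epsilon> > 0"
  shows "integrable lborel (\<lambda>\<xi>. complex_of_real (exp (- \<epsilon> * \<xi>\<^sup>2 / 2)) * cis (\<xi> * x))"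
proof (rule Bochner_Integration.integrable_bound)
  have "exp (- \<epsilon> * \<xi>\<^sup>2 / 2) = sqrt (2 * pi / \<epsilon>) * normal_density 0 (1 / sqrt \<epsilon>) \<xi>" for \<xi>
    using assms by (simp add: normal_density_def real_sqrt_divide real_sqrt_mult power_divide field_simps)
  then show "integrable lborel (\<lambda>\<xi>. exp (- \<epsilon> * \<xi>\<^sup>2 / 2))"
    using assms by simp
qed (auto simp: norm_mult intro!: borel_measurable_continuous_onI continuous_intros)

text \<open>Rescaling the frequency by \<open>sqrt \<epsilon>\<close> turns the left side into a
  multiple of the characteristic function of the standard normal law at
  \<open>x / sqrt \<epsilon>\<close>.\<close>

lemma heat_kernel_fourier:
  fixes \<epsilon> x :: real
  assumes "\<epsilon> > 0"
  shows "(\<integral>\<xi>. complex_of_real (exp (- \<epsilon> * \<xi>\<^sup>2 / 2)) * cis (\<xi> * x) \<partial>lborel)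
    = complex_of_real (2 * pi * heat_kernel \<epsilon> x)"
proof -
  define s where "s = sqrt \<epsilon>"
  have s: "s > 0" "\<epsilon> = s\<^sup>2" using assms by (auto simp: s_def)
  have "(\<integral>\<xi>. complex_of_real (exp (- \<epsilon> * \<xi>\<^sup>2 / 2)) * cis (\<xi> * x) \<partial>lborel)
     = \<bar>1 / s\<bar> *\<^sub>R (\<integral>y. complex_of_real (exp (- \<epsilon> * (0 + (1 / s) * y)\<^sup>2 / 2)) * cis ((0 + (1 / s) * y) * x) \<partial>lborel)"
    by (rule lborel_integral_real_affine) (use s in auto)
  also have "(\<lambda>y. complex_of_real (exp (- \<epsilon> * (0 + (1 / s) * y)\<^sup>2 / 2)) * cis ((0 + (1 / s) * y) * x))
     = (\<lambda>y. complex_of_real (sqrt (2 * pi)) * (std_normal_density y *\<^sub>R iexp ((x / s) * y)))"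
    using s by (auto simp: fun_eq_iff std_normal_density_def cis_conv_exp scaleR_conv_of_real power_mult_distrib field_simps)
  also have "(\<integral>y. complex_of_real (sqrt (2 * pi)) * (std_normal_density y *\<^sub>R iexp ((x / s) * y)) \<partial>lborel)
     = complex_of_real (sqrt (2 * pi)) * char std_normal_distribution (x / s)"
    unfolding char_def by (subst integral_density, simp, simp, simp, rule integral_mult_right_zero[symmetric, THEN sym])
  also have "\<dots> = complex_of_real (sqrt (2 * pi) * exp (- (x / s)\<^sup>2 / 2))"
    by (simp add: char_std_normal_distribution)
  also have "\<bar>1 / s\<bar> *\<^sub>R \<dots> = complex_of_real (2 * pi * heat_kernel \<epsilon> x)"
  proof -
    have "1 / s * (sqrt (2 * pi) * E) = 2 * pi * (1 / sqrt (2 * pi * \<epsilon>) * E)" for E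
    proof -
      have "sqrt (2 * pi * \<epsilon>) = sqrt (2 * pi) * s" using s by (simp add: real_sqrt_mult)
      moreover have "2 * pi = sqrt (2 * pi) * sqrt (2 * pi)" by simp
      ultimately show ?thesis using s by (simp add: field_simps)
    qed
    moreover have "(x / s)\<^sup>2 / 2 = x\<^sup>2 / (2 * \<epsilon>)" using s by (simp add: power_divide)
    ultimately show ?thesis
      using s unfolding heat_kernel_def scaleR_conv_of_real of_real_mult[symmetric]
      by (intro arg_cong[where f=complex_of_real]) auto
  qed
  finally show ?thesis .
qed

section \<open>The standard normal tail, which gives the slope of the covariance up to sign\<close>

definition gauss_tail :: "real \<Rightarrow> real" where
  "gauss_tail x = 1 - cdf std_normal_distribution x"

lemma gauss_tail_diff:
  assumes "a \<le> b"
  shows "gauss_tail a - gauss_tail b = integral {a..b} std_normal_density"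
proof -
  interpret real_distribution std_normal_distribution by (rule real_dist_normal_dist)
  have ac: "continuous_on {a..b} std_normal_density"
    unfolding std_normal_density_def by (intro continuous_intros) auto
  have "gauss_tail a - gauss_tail b = measure std_normal_distribution {a<..b}"
    using assms cdf_diff_eq[of a b] by (cases "a = b") (simp_all add: gauss_tail_def)
  also have "\<dots> = (LINT x:{a<..b}|lborel. std_normal_density x)"
    using integral_density[of "indicator {a<..b} :: real \<Rightarrow> real" lborel std_normal_density]
    by (simp add: set_lebesgue_integral_def mult.commute)
  also have "\<dots> = (LINT x:{a..b}|lborel. std_normal_density x)"
    unfolding set_lebesgue_integral_def
    by (intro integral_cong_AE) (auto intro!: AE_I[OF _ _ , of _ _ "{a}"] simp: indicator_def)
  also have "\<dots> = integral {a..b} std_normal_density"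
    by (intro set_borel_integral_eq_integral borel_integrable_atLeastAtMost' ac)
  finally show ?thesis .
qed

text \<open>On the window \<open>{x-1..x+1}\<close> the tail is a constant minus the integral of the
  density from \<open>x-1\<close>, so the fundamental theorem of calculus applies; \<open>x\<close>
  is interior, so the one-window derivative is the full one.\<close>

lemma gauss_tail_DERIV: "(gauss_tail has_real_derivative - std_normal_density x) (at x)"
proof -
  let ?f = std_normal_density
  have ac: "continuous_on {x-1..x+1} ?f"
    unfolding std_normal_density_def by (intro continuous_intros) auto
  have "((\<lambda>u. integral {x-1..u} ?f) has_real_derivative ?f x) (at x within {x-1..x+1})"
    by (rule integral_has_real_derivative[OF ac]) auto
  then have "((\<lambda>u. gauss_tail (x-1) - integral {x-1..u} ?f) has_real_derivative - ?f x) (at x within {x-1..x+1})"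
    by (auto intro!: derivative_eq_intros)
  then have "(gauss_tail has_real_derivative - ?f x) (at x within {x-1..x+1})"
    by (rule has_field_derivative_transform_within[where d=1]) (auto simp: gauss_tail_diff[symmetric])
  then have "(gauss_tail has_real_derivative - ?f x) (at x within {x-1<..<x+1})"
    by (rule DERIV_subset) auto
  then show ?thesis
    by (subst (asm) at_within_open) auto
qed

lemmas gauss_tail_DERIV' [derivative_intros] = gauss_tail_DERIV[THEN DERIV_chain2]

lemma gauss_tail_antimono: "a \<le> b \<Longrightarrow> gauss_tail b \<le> gauss_tail a"
proof -
  interpret real_distribution std_normal_distribution by (rule real_dist_normal_dist)
  show "a \<le> b \<Longrightarrow> gauss_tail b \<le> gauss_tail a"
    using cdf_nondecreasing by (simp add: gauss_tail_def)
qed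

lemma gauss_tail_tendsto: "(gauss_tail \<longlongrightarrow> 0) at_top"
proof -
  interpret real_distribution std_normal_distribution by (rule real_dist_normal_dist)
  have "((\<lambda>x. 1 - cdf std_normal_distribution x) \<longlongrightarrow> 1 - 1) at_top"
    by (intro tendsto_intros cdf_lim_at_top_prob)
  then show ?thesis by (simp add: gauss_tail_def[abs_def])
qed

text \<open>A nonnegative strictly decreasing function has no zero. Strict positivity is what makes
  the constant of local nondeterminism useful.\<close>

lemma gauss_tail_pos: "0 < gauss_tail x"
proof -
  interpret real_distribution std_normal_distribution by (rule real_dist_normal_dist)
  have "gauss_tail (x + 1) < gauss_tail x"
    by (rule DERIV_neg_imp_decreasing) (auto intro!: exI gauss_tail_DERIV normal_density_pos)
  moreover have "0 \<le> gauss_tail (x + 1)"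
    using cdf_bounded_prob by (simp add: gauss_tail_def)
  ultimately show ?thesis by simp
qed

text \<open>The covariance of the solution at time 1, in closed form.\<close>

definition heat_cov :: "real \<Rightarrow> real" where
  "heat_cov d = 2 * heat_kernel 2 d - d * gauss_tail (d / sqrt 2)"

text \<open>Differentiating the kernel term gives \<open>- d * heat_kernel 2 d\<close>, and
  differentiating inside the tail gives the same with the opposite sign; only the tail itself
  survives.\<close>

lemma heat_cov_DERIV: "(heat_cov has_real_derivative - gauss_tail (d / sqrt 2)) (at d)"
proof -
  have e: "std_normal_density (d / sqrt 2) / sqrt 2 = heat_kernel 2 d"
    by (simp add: std_normal_density_def heat_kernel_def power_divide real_sqrt_mult)
  have "((\<lambda>d. heat_kernel 2 d) has_real_derivative - (d / 2) * heat_kernel 2 d) (at d)"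
    unfolding heat_kernel_def by (auto intro!: derivative_eq_intros simp: field_simps)
  moreover have "((\<lambda>d. gauss_tail (d / sqrt 2)) has_real_derivative
      - std_normal_density (d / sqrt 2) * (1 / sqrt 2)) (at d)"
    by (intro gauss_tail_DERIV' DERIV_cdivide DERIV_ident)
  ultimately have "(heat_cov has_real_derivative 2 * (- (d / 2) * heat_kernel 2 d)
     - (1 * gauss_tail (d / sqrt 2) + (- std_normal_density (d / sqrt 2) * (1 / sqrt 2)) * d)) (at d)"
    unfolding heat_cov_def[abs_def]
    by (intro DERIV_diff DERIV_cmult DERIV_mult DERIV_ident)
  then show ?thesis unfolding e[symmetric] by (simp add: field_simps)
qed

text \<open>Convexity in the form needed for covariances: the drop over a step \<open>h\<close> gets
  smaller with distance, because its derivative is a difference of two values of the decreasing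
  tail. This yields the sign of the covariance of two disjoint increments.\<close>

lemma heat_cov_convex:
  assumes "a \<le> b" "0 \<le> h"
  shows "heat_cov a - heat_cov (a + h) \<ge> heat_cov b - heat_cov (b + h)"
proof -
  have "(\<lambda>a. heat_cov a - heat_cov (a + h)) b \<le> (\<lambda>a. heat_cov a - heat_cov (a + h)) a"
  proof (rule DERIV_nonpos_imp_nonincreasing[OF \<open>a \<le> b\<close>])
    fix x
    have "((\<lambda>a. heat_cov a - heat_cov (a + h)) has_real_derivative
       - gauss_tail (x / sqrt 2) - - gauss_tail ((x + h) / sqrt 2)) (at x)"
      by (intro DERIV_diff heat_cov_DERIV DERIV_shift[THEN iffD1])
    moreover have "gauss_tail ((x + h) / sqrt 2) \<le> gauss_tail (x / sqrt 2)"
      using assms by (intro gauss_tail_antimono divide_right_mono) auto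
    ultimately show "\<exists>y. ((\<lambda>a. heat_cov a - heat_cov (a + h)) has_real_derivative y) (at x) \<and> y \<le> 0"
      by fastforce
  qed
  then show ?thesis .
qed

text \<open>Up to \<open>l\<close> the slope is at most \<open>- gauss_tail (l / sqrt 2)\<close>,
  since the tail is smallest at the right end. The drop is thus linear in \<open>h\<close>, which is
  the Brownian order of magnitude.\<close>

lemma heat_cov_decrease:
  assumes "0 \<le> h" "a + h \<le> l"
  shows "heat_cov a - heat_cov (a + h) \<ge> gauss_tail (l / sqrt 2) * h"
proof -
  have "(\<lambda>x. heat_cov x + gauss_tail (l / sqrt 2) * x) (a + h) \<le> (\<lambda>x. heat_cov x + gauss_tail (l / sqrt 2) * x) a"
  proof (rule DERIV_nonpos_imp_nonincreasing[of a "a + h"])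
    fix x assume "a \<le> x" "x \<le> a + h"
    have "((\<lambda>x. heat_cov x + gauss_tail (l / sqrt 2) * x) has_real_derivative
       - gauss_tail (x / sqrt 2) + gauss_tail (l / sqrt 2)) (at x)"
      by (intro DERIV_add heat_cov_DERIV DERIV_cmult_Id)
    moreover have "gauss_tail (l / sqrt 2) \<le> gauss_tail (x / sqrt 2)"
      using assms \<open>x \<le> a + h\<close> by (intro gauss_tail_antimono divide_right_mono) auto
    ultimately show "\<exists>y. ((\<lambda>x. heat_cov x + gauss_tail (l / sqrt 2) * x) has_real_derivative y) (at x) \<and> y \<le> 0"
      by fastforce
  qed (use assms in auto)
  then show ?thesis by (simp add: algebra_simps)
qed

text \<open>With \<open>r = 1 - s\<close> the integrand becomes
  \<open>heat_kernel (2 * r) d\<close>, which has an explicit primitive in \<open>r\<close>; at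
  \<open>r = 1\<close> the primitive is \<open>heat_cov d\<close>.\<close>

lemma heat_kernel_time_has_integral:
  assumes d: "d \<ge> 0"
  shows "((\<lambda>s. heat_kernel (2 * (1 - s)) d) has_integral heat_cov d) {0..1}"
proof -
  \<comment> \<open>The value at 0 must be set by hand: division by zero would turn the second term
    into \<open>d * gauss_tail 0\<close>, and \<open>G\<close> would jump at 0 when
    \<open>d > 0\<close>.\<close>
  define G where "G r = (if r = 0 then 0 else 2 * r * heat_kernel (2 * r) d - d * gauss_tail (d / sqrt (2 * r)))" for r
  have G_deriv: "(G has_real_derivative heat_kernel (2 * r) d) (at r)" if r: "r > 0" for r
  proof -
    define q where "q = sqrt (2 * r)"
    have q: "q > 0" "2 * r = q\<^sup>2" using r by (auto simp: q_def)
    have h: "heat_kernel (2 * r) d = std_normal_density (d / q) / q"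
      using q by (simp add: heat_kernel_def std_normal_density_def power_divide real_sqrt_mult)
    have eq: "eventually (\<lambda>r. G r = sqrt (2 * r) * std_normal_density (d / sqrt (2 * r)) - d * gauss_tail (d / sqrt (2 * r))) (nhds r)"
      using eventually_nhds_in_open[of "{0<..}" r] r
      by (auto elim!: eventually_mono simp: G_def heat_kernel_def std_normal_density_def real_sqrt_mult power_divide field_simps)
    have sd: "((\<lambda>x. std_normal_density x) has_real_derivative - x * std_normal_density x) (at x)" for x
      unfolding std_normal_density_def by (rule derivative_eq_intros refl | simp)+
    have ds: "((\<lambda>r. sqrt (2 * r)) has_real_derivative 1 / q) (at r)"
      using r by (auto intro!: derivative_eq_intros simp: q_def field_simps)
    have dd: "((\<lambda>r. d / sqrt (2 * r)) has_real_derivative - d / q ^ 3) (at r)"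
      using q by (auto intro!: derivative_eq_intros ds simp: q_def[symmetric] field_simps eval_nat_numeral)
    have "((\<lambda>r. sqrt (2 * r) * std_normal_density (d / sqrt (2 * r)) - d * gauss_tail (d / sqrt (2 * r)))
       has_real_derivative ((1 / q) * std_normal_density (d / q) + ((- (d / q) * std_normal_density (d / q)) * (- d / q ^ 3)) * q
         - d * (- std_normal_density (d / q) * (- d / q ^ 3)))) (at r)"
      by (rule derivative_eq_intros ds dd sd[THEN DERIV_chain2] gauss_tail_DERIV' | simp add: q_def)+
    \<comment> \<open>The two terms quadratic in \<open>d\<close>, one from the density and one from
      the tail, cancel; this is why the tail term belongs to the primitive.\<close>
    also have "((1 / q) * std_normal_density (d / q) + ((- (d / q) * std_normal_density (d / q)) * (- d / q ^ 3)) * q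
         - d * (- std_normal_density (d / q) * (- d / q ^ 3))) = heat_kernel (2 * r) d"
      unfolding h using q by (simp add: field_simps eval_nat_numeral)
    finally show ?thesis
      by (subst DERIV_cong_ev[OF refl eq refl])
  qed
  have G0: "(G \<longlongrightarrow> G 0) (at_right 0)"
  proof -
    have ev: "eventually (\<lambda>r. sqrt (2 * r) * std_normal_density (d / sqrt (2 * r)) - d * gauss_tail (d / sqrt (2 * r)) = G r) (at_right 0)"
      by (auto simp: eventually_at_filter G_def heat_kernel_def std_normal_density_def real_sqrt_mult power_divide field_simps)
    have "((\<lambda>r. sqrt (2 * r) * std_normal_density (d / sqrt (2 * r))) \<longlongrightarrow> 0) (at_right 0)"
    proof (rule Lim_null_comparison)
      show "((\<lambda>r. sqrt (2 * r)) \<longlongrightarrow> 0) (at_right 0)"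
        by (auto intro!: tendsto_eq_intros)
      show "\<forall>\<^sub>F r in at_right 0. norm (sqrt (2 * r) * std_normal_density (d / sqrt (2 * r))) \<le> sqrt (2 * r)"
      proof (rule eventually_at_right_less[THEN eventually_mono])
        fix r :: real assume "0 < r"
        have "std_normal_density (d / sqrt (2 * r)) \<le> 1 / sqrt (2 * pi) * 1"
          unfolding std_normal_density_def by (intro mult_left_mono) auto
        also have "\<dots> \<le> 1" using pi_gt3 by (simp add: divide_simps)
        finally show "norm (sqrt (2 * r) * std_normal_density (d / sqrt (2 * r))) \<le> sqrt (2 * r)"
          using \<open>0 < r\<close> by (simp add: abs_mult mult_left_le)
      qed
    qed
    \<comment> \<open>For \<open>d > 0\<close> the argument of the tail runs to infinity; for
      \<open>d = 0\<close> the factor in front vanishes.\<close>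
    moreover have "((\<lambda>r. d * gauss_tail (d / sqrt (2 * r))) \<longlongrightarrow> 0) (at_right 0)"
    proof (cases "d = 0")
      case False
      then have "d > 0" using d by simp
      have "filterlim (\<lambda>r. d / sqrt (2 * r)) at_top (at_right 0)"
      proof (rule filterlim_compose[OF filterlim_tendsto_pos_mult_at_top[OF tendsto_const \<open>d > 0\<close> filterlim_inverse_at_top_right, unfolded divide_inverse[symmetric]]])
        show "filterlim (\<lambda>r::real. sqrt (2 * r)) (at_right 0) (at_right 0)"
          by (auto simp: filterlim_at eventually_at_filter intro!: tendsto_eq_intros)
      qed
      then have "((\<lambda>r. d * gauss_tail (d / sqrt (2 * r))) \<longlongrightarrow> d * 0) (at_right 0)"
        by (intro tendsto_intros filterlim_compose[OF gauss_tail_tendsto])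
      then show ?thesis by simp
    qed simp
    ultimately have "((\<lambda>r. sqrt (2 * r) * std_normal_density (d / sqrt (2 * r)) - d * gauss_tail (d / sqrt (2 * r))) \<longlongrightarrow> 0 - 0) (at_right 0)"
      by (rule tendsto_diff)
    then show ?thesis
      using tendsto_cong[OF ev] by (simp add: G_def[of 0])
  qed
  have contG: "continuous_on {0..1} G"
    unfolding continuous_on_eq_continuous_within
  proof
    fix r :: real assume r: "r \<in> {0..1}"
    show "continuous (at r within {0..1}) G"
    proof (cases "r = 0")
      case True
      then show ?thesis using G0
        by (simp add: continuous_within at_within_Icc_at_right)
    next
      case False
      then show ?thesis using r G_deriv[of r] DERIV_isCont continuous_at_imp_continuous_within by force
    qed
  qed
  have "((\<lambda>s. heat_kernel (2 * (1 - s)) d) has_integral - G (1 - 1) - - G (1 - 0)) {0..1}"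
  proof (rule fundamental_theorem_of_calculus_interior)
    show "continuous_on {0..1} (\<lambda>s. - G (1 - s))"
      by (intro continuous_intros continuous_on_compose2[OF contG]) auto
    fix s :: real assume "s \<in> {0<..<1}"
    moreover have "((\<lambda>s. 1 - s) has_real_derivative - 1) (at s)"
      by (auto intro!: derivative_eq_intros)
    ultimately have "((\<lambda>s. - G (1 - s)) has_real_derivative - (heat_kernel (2 * (1 - s)) d * (- 1))) (at s)"
      by (intro DERIV_minus DERIV_chain2[OF G_deriv]) auto
    then show "((\<lambda>s. - G (1 - s)) has_vector_derivative heat_kernel (2 * (1 - s)) d) (at s)"
      by (simp add: has_real_derivative_iff_has_vector_derivative)
  qed auto
  then show ?thesis
    by (simp add: G_def heat_cov_def)
qed

lemma heat_cov_nonneg: "d \<ge> 0 \<Longrightarrow> heat_cov d \<ge> 0"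
  by (rule has_integral_nonneg[OF heat_kernel_time_has_integral]) auto

lemma nn_integral_heat_kernel_time:
  assumes "d \<ge> 0"
  shows "(\<integral>\<^sup>+ s \<in> {0..1}. ennreal (heat_kernel (2 * (1 - s)) d) \<partial>lborel) = ennreal (heat_cov d)"
proof -
  have "((\<lambda>s. if s \<in> {0..1} then heat_kernel (2 * (1 - s)) d else 0) has_integral heat_cov d) UNIV"
    using heat_kernel_time_has_integral[OF assms] by (simp only: has_integral_restrict_UNIV)
  then have "(\<integral>\<^sup>+ s. ennreal (if s \<in> {0..1} then heat_kernel (2 * (1 - s)) d else 0) \<partial>lborel) = ennreal (heat_cov d)"
    by (rule nn_integral_has_integral_lborel[rotated 2]) auto
  then show ?thesis
    by (auto simp: indicator_def if_distrib intro!: nn_integral_cong elim!: trans[rotated])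
qed

section \<open>Local nondeterminism\<close>

lemma borel_measurable_strip [measurable (raw)]:
  "f \<in> borel_measurable borel \<Longrightarrow> f \<in> borel_measurable strip"
  unfolding strip_def by (rule measurable_restrict_space1) simp

lemma nn_integral_strip:
  assumes [measurable]: "f \<in> borel_measurable borel"
  shows "(\<integral>\<^sup>+ z. f z \<partial>strip) = (\<integral>\<^sup>+ s \<in> {0..1}. (\<integral>\<^sup>+ v. f (v, s) \<partial>lborel) \<partial>lborel)"
proof -
  have [measurable]: "f \<in> borel_measurable (lborel \<Otimes>\<^sub>M lborel)"
    by (simp add: lborel_prod)
  have "UNIV \<times> {0..1::real} \<in> sets (borel :: (real \<times> real) measure)"
    by (intro borel_closed closed_Times) auto
  then have "(\<integral>\<^sup>+ z. f z \<partial>strip) = (\<integral>\<^sup>+ z. f z * indicator (UNIV \<times> {0..1}) z \<partial>(lborel \<Otimes>\<^sub>M lborel))"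
    unfolding strip_def by (subst nn_integral_restrict_space) (auto simp: lborel_prod)
  also have "\<dots> = (\<integral>\<^sup>+ s. (\<integral>\<^sup>+ v. f (v, s) * indicator (UNIV \<times> {0..1}) (v, s) \<partial>lborel) \<partial>lborel)"
    by (rule lborel_pair.nn_integral_snd[symmetric]) simp
  also have "\<dots> = (\<integral>\<^sup>+ s \<in> {0..1}. (\<integral>\<^sup>+ v. f (v, s) \<partial>lborel) \<partial>lborel)"
    by (intro nn_integral_cong) (auto simp: indicator_def)
  finally show ?thesis .
qed

abbreviation green :: "real \<Rightarrow> real \<times> real \<Rightarrow> real" where
  "green u \<equiv> \<lambda>(v, s). heat_kernel (1 - s) (u - v)"

lemma borel_measurable_green [measurable]: "green u \<in> borel_measurable borel"
  unfolding borel_prod[symmetric] by measurable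

lemma heat_kernel_minus [simp]: "heat_kernel t (- u) = heat_kernel t u"
  by (simp add: heat_kernel_def)

lemma heat_kernel_abs [simp]: "heat_kernel t \<bar>u\<bar> = heat_kernel t u"
  by (simp add: heat_kernel_def)

text \<open>By symmetry and a shift this is the convolution of two centered normal densities of
  variance \<open>t\<close>. For \<open>t = 0\<close>, reached at \<open>s = 1\<close>, both sides
  have the default value 0.\<close>

lemma heat_kernel_convolution:
  assumes "t \<ge> 0"
  shows "(\<integral>\<^sup>+ v. ennreal (heat_kernel t (a - v) * heat_kernel t (b - v)) \<partial>lborel) = ennreal (heat_kernel (2 * t) (a - b))"
proof (cases "t = 0")
  case False
  with assms have t: "t > 0" by simp
  have "(\<integral>\<^sup>+ v. ennreal (heat_kernel t (a - v) * heat_kernel t (b - v)) \<partial>lborel)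
     = (\<integral>\<^sup>+ v. ennreal (heat_kernel t (a - (b + 1 * v)) * heat_kernel t (b - (b + 1 * v))) \<partial>lborel)"
    by (subst nn_integral_real_affine[where c=1 and t=b]) auto
  also have "\<dots> = (\<integral>\<^sup>+ v. ennreal (normal_density 0 (sqrt t) ((a - b) - v) * normal_density 0 (sqrt t) v) \<partial>lborel)"
    using t by (simp add: heat_kernel_eq_normal_density[symmetric] algebra_simps)
  also have "\<dots> = ennreal (normal_density 0 (sqrt ((sqrt t)\<^sup>2 + (sqrt t)\<^sup>2)) (a - b))"
    using conv_normal_density_zero_mean[of "sqrt t" "sqrt t"] t by (simp add: fun_eq_iff)
  also have "\<dots> = ennreal (heat_kernel (2 * t) (a - b))"
    using t by (simp add: heat_kernel_eq_normal_density)
  finally show ?thesis .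
qed (simp add: heat_kernel_def)

text \<open>Integrating over space first merges the two kernels by the semigroup property, and the
  remaining time integral is \<open>heat_cov\<close>. Nonnegativity of the kernels lets one
  computation give both integrability and the value.\<close>

lemma green_cov:
  shows integrable_green_mult: "integrable strip (\<lambda>z. green a z * green b z)"
    and integral_green_mult: "(\<integral>z. green a z * green b z \<partial>strip) = heat_cov \<bar>a - b\<bar>"
proof -
  have "(\<integral>\<^sup>+ z. ennreal (green a z * green b z) \<partial>strip)
     = (\<integral>\<^sup>+ s \<in> {0..1}. (\<integral>\<^sup>+ v. ennreal (heat_kernel (1 - s) (a - v) * heat_kernel (1 - s) (b - v)) \<partial>lborel) \<partial>lborel)"
    by (subst nn_integral_strip) auto
  also have "\<dots> = (\<integral>\<^sup>+ s \<in> {0..1}. ennreal (heat_kernel (2 * (1 - s)) \<bar>a - b\<bar>) \<partial>lborel)"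
    using heat_kernel_convolution by (intro nn_integral_cong) (auto simp: indicator_def)
  also have "\<dots> = ennreal (heat_cov \<bar>a - b\<bar>)"
    by (rule nn_integral_heat_kernel_time) simp
  finally have "has_bochner_integral strip (\<lambda>z. green a z * green b z) (heat_cov \<bar>a - b\<bar>)"
    by (intro has_bochner_integral_nn_integral)
      (auto simp: strip_def space_restrict_space heat_cov_nonneg intro!: AE_I2 measurable_restrict_space1)
  then show "integrable strip (\<lambda>z. green a z * green b z)"
    "(\<integral>z. green a z * green b z \<partial>strip) = heat_cov \<bar>a - b\<bar>"
    by (simp_all add: has_bochner_integral_iff)
qed

lemma L2_strip_green: "green u \<in> L2_strip"
  using integrable_green_mult[of u u] by (simp add: L2_strip_def power2_eq_square borel_measurable_strip)

lemma L2_strip_lincomb: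
  assumes "f \<in> L2_strip" "g \<in> L2_strip"
  shows "(\<lambda>z. a * f z + b * g z) \<in> L2_strip"
proof -
  have [measurable]: "f \<in> borel_measurable strip" "g \<in> borel_measurable strip"
    and i: "integrable strip (\<lambda>z. (f z)\<^sup>2)" "integrable strip (\<lambda>z. (g z)\<^sup>2)"
    using assms by (auto simp: L2_strip_def)
  have "integrable strip (\<lambda>z. (a * f z + b * g z)\<^sup>2)"
  proof (rule Bochner_Integration.integrable_bound)
    show "integrable strip (\<lambda>z. 2 * a\<^sup>2 * (f z)\<^sup>2 + 2 * b\<^sup>2 * (g z)\<^sup>2)"
      using i by auto
    have "(a * f z + b * g z)\<^sup>2 \<le> 2 * a\<^sup>2 * (f z)\<^sup>2 + 2 * b\<^sup>2 * (g z)\<^sup>2" for z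
      using zero_le_power2[of "a * f z - b * g z"] by (simp add: power2_eq_square algebra_simps)
    then show "AE z in strip. norm ((a * f z + b * g z)\<^sup>2) \<le> norm (2 * a\<^sup>2 * (f z)\<^sup>2 + 2 * b\<^sup>2 * (g z)\<^sup>2)"
      by (auto intro!: AE_I2)
  qed measurable
  then show ?thesis by (simp add: L2_strip_def)
qed

lemma green_increment_cov:
  shows integrable_green_increment_mult:
      "integrable strip (\<lambda>z. (green a z - green b z) * (green c z - green d z))"
    and integral_green_increment_mult:
      "(\<integral>z. (green a z - green b z) * (green c z - green d z) \<partial>strip)
        = heat_cov \<bar>a - c\<bar> - heat_cov \<bar>a - d\<bar> - heat_cov \<bar>b - c\<bar> + heat_cov \<bar>b - d\<bar>"
proof -
  have e: "(green a z - green b z) * (green c z - green d z)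
     = green a z * green c z - green a z * green d z - green b z * green c z + green b z * green d z" for z
    by (cases z) (simp add: algebra_simps)
  show "integrable strip (\<lambda>z. (green a z - green b z) * (green c z - green d z))"
    unfolding e by (intro Bochner_Integration.integrable_add Bochner_Integration.integrable_diff integrable_green_mult)
  show "(\<integral>z. (green a z - green b z) * (green c z - green d z) \<partial>strip)
        = heat_cov \<bar>a - c\<bar> - heat_cov \<bar>a - d\<bar> - heat_cov \<bar>b - c\<bar> + heat_cov \<bar>b - d\<bar>"
    unfolding e
    by (simp only: Bochner_Integration.integral_add Bochner_Integration.integral_diff integral_green_mult
        Bochner_Integration.integrable_add Bochner_Integration.integrable_diff integrable_green_mult)
qed

text \<open>Off the diagonal \<open>\<mu> i * \<mu> j\<close> is at most the mean of the squares,
  and multiplying by a nonpositive entry reverses this inequality. By symmetry, both squares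
  contribute the same row sums.\<close>

lemma quadratic_form_diag_dominant:
  fixes G :: "'i \<Rightarrow> 'i \<Rightarrow> real"
  assumes sym: "\<And>i j. i \<in> I \<Longrightarrow> j \<in> I \<Longrightarrow> G i j = G j i"
    and off: "\<And>i j. i \<in> I \<Longrightarrow> j \<in> I \<Longrightarrow> i \<noteq> j \<Longrightarrow> G i j \<le> 0"
  shows "(\<Sum>i\<in>I. (\<mu> i)\<^sup>2 * (\<Sum>j\<in>I. G i j)) \<le> (\<Sum>i\<in>I. \<Sum>j\<in>I. \<mu> i * \<mu> j * G i j)"
proof -
  have "(\<Sum>i\<in>I. \<Sum>j\<in>I. (\<mu> j)\<^sup>2 * G i j) = (\<Sum>i\<in>I. \<Sum>j\<in>I. (\<mu> i)\<^sup>2 * G i j)"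
    by (subst sum.swap) (auto intro!: sum.cong simp: sym)
  then have "(\<Sum>i\<in>I. (\<mu> i)\<^sup>2 * (\<Sum>j\<in>I. G i j)) = (\<Sum>i\<in>I. \<Sum>j\<in>I. ((\<mu> i)\<^sup>2 + (\<mu> j)\<^sup>2) / 2 * G i j)"
    by (simp add: sum_distrib_left sum.distrib add_divide_distrib distrib_right sum_divide_distrib[symmetric])
  also have "\<dots> \<le> (\<Sum>i\<in>I. \<Sum>j\<in>I. \<mu> i * \<mu> j * G i j)"
  proof (intro sum_mono)
    fix i j assume ij: "i \<in> I" "j \<in> I"
    show "((\<mu> i)\<^sup>2 + (\<mu> j)\<^sup>2) / 2 * G i j \<le> \<mu> i * \<mu> j * G i j"
    proof (cases "i = j")
      case False
      have "\<mu> i * \<mu> j \<le> ((\<mu> i)\<^sup>2 + (\<mu> j)\<^sup>2) / 2"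
        using zero_le_power2[of "\<mu> i - \<mu> j"] by (simp add: power2_eq_square algebra_simps)
      then show ?thesis using off[OF ij False] by (rule mult_right_mono_neg)
    qed (simp add: power2_eq_square)
  qed
  finally show ?thesis .
qed

lemma antitone_upto:
  fixes t :: "nat \<Rightarrow> real"
  assumes "\<And>j. j < k \<Longrightarrow> t (Suc j) \<le> t j" "i \<le> j" "j \<le> k"
  shows "t j \<le> t i"
  using \<open>i \<le> j\<close> \<open>j \<le> k\<close>
proof (induction j rule: dec_induct)
  case (step n)
  then show ?case using assms(1)[of n] by simp
qed simp

text \<open>The times are meant to decrease, so \<open>\<mu> j\<close> weights the interval from
  \<open>t (Suc j)\<close> to \<open>t j\<close>; new times are appended at the left end, as in the
  recursion for the moments. By the isometry, the integral of the square is the variance of the same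
  combination of increments of the solution.\<close>

definition increments :: "nat \<Rightarrow> (nat \<Rightarrow> real) \<Rightarrow> (nat \<Rightarrow> real) \<Rightarrow> real \<times> real \<Rightarrow> real" where
  "increments k \<mu> t z = (\<Sum>j<k. \<mu> j * (green (t j) z - green (t (Suc j)) z))"

text \<open>
  Local nondeterminism. The increments over disjoint intervals are negatively correlated, so their
  Gram matrix is diagonally dominant; its row sums telescope.
\<close>

lemma increments_norm_ge:
  assumes t: "\<And>j. j < k \<Longrightarrow> t (Suc j) \<le> t j" and l: "t 0 - t k \<le> l"
  shows "gauss_tail (l / sqrt 2) * (\<Sum>j<k. (\<mu> j)\<^sup>2 * (t j - t (Suc j))) \<le> (\<integral>z. (increments k \<mu> t z)\<^sup>2 \<partial>strip)"
proof -
  define d where "d j z = green (t j) z - green (t (Suc j)) z" for j z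
  define G where "G i j = (\<integral>z. d i z * d j z \<partial>strip)" for i j
  have mono: "i \<le> j \<Longrightarrow> j \<le> k \<Longrightarrow> t j \<le> t i" for i j
    using antitone_upto[of k t i j] t by blast
  have G: "G i j = heat_cov \<bar>t i - t j\<bar> - heat_cov \<bar>t i - t (Suc j)\<bar> - heat_cov \<bar>t (Suc i) - t j\<bar> + heat_cov \<bar>t (Suc i) - t (Suc j)\<bar>" for i j
    unfolding G_def d_def by (rule integral_green_increment_mult)
  have G_sym: "G i j = G j i" for i j
    unfolding G_def by (simp add: mult.commute)
  have int: "integrable strip (\<lambda>z. d i z * d j z)" for i j
    unfolding d_def by (rule integrable_green_increment_mult)
  have "(\<integral>z. (increments k \<mu> t z)\<^sup>2 \<partial>strip) = (\<integral>z. (\<Sum>i<k. \<Sum>j<k. \<mu> i * \<mu> j * (d i z * d j z)) \<partial>strip)"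
    unfolding increments_def d_def[symmetric] power2_eq_square sum_product by (simp add: mult_ac)
  also have "\<dots> = (\<Sum>i<k. \<Sum>j<k. \<mu> i * \<mu> j * G i j)"
    unfolding G_def
    by (simp only: Bochner_Integration.integral_sum Bochner_Integration.integrable_sum integrable_mult_right[OF int] integral_mult_right_zero)
  also have "\<dots> \<ge> (\<Sum>i<k. (\<mu> i)\<^sup>2 * (\<Sum>j<k. G i j))"
  proof (rule quadratic_form_diag_dominant)
    \<comment> \<open>As the intervals are disjoint, all absolute values open. What remains is the
      drop of \<open>heat_cov\<close> over the length of the left interval, taken at the larger
      distance, minus the drop at the smaller distance.\<close>
    have off: "G i j \<le> 0" if "i < j" "j < k" for i j
    proof -
      have "t i \<ge> t (Suc i)" "t (Suc i) \<ge> t j" "t j \<ge> t (Suc j)"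
        using that mono[of i "Suc i"] mono[of "Suc i" j] mono[of j "Suc j"] by auto
      then show ?thesis
        using heat_cov_convex[of "t (Suc i) - t j" "t i - t j" "t j - t (Suc j)"]
        unfolding G by (simp add: algebra_simps)
    qed
    show "G i j \<le> 0" if "i \<in> {..<k}" "j \<in> {..<k}" "i \<noteq> j" for i j
      using that off[of i j] off[of j i] G_sym[of i j] by (cases "i < j") auto
  qed (rule G_sym)
  also have "(\<Sum>i<k. (\<mu> i)\<^sup>2 * (\<Sum>j<k. G i j)) \<ge> (\<Sum>i<k. (\<mu> i)\<^sup>2 * (gauss_tail (l / sqrt 2) * (t i - t (Suc i))))"
  proof (intro sum_mono mult_left_mono zero_le_power2)
    fix i assume i: "i \<in> {..<k}"
    have o: "t 0 \<ge> t i" "t i \<ge> t (Suc i)" "t (Suc i) \<ge> t k"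
      using i mono[of 0 i] mono[of i "Suc i"] mono[of "Suc i" k] by auto
    have "(\<Sum>j<k. G i j) = (\<Sum>j<k. (heat_cov \<bar>t i - t j\<bar> - heat_cov \<bar>t (Suc i) - t j\<bar>)
       - (heat_cov \<bar>t i - t (Suc j)\<bar> - heat_cov \<bar>t (Suc i) - t (Suc j)\<bar>))"
      unfolding G by (simp add: algebra_simps)
    \<comment> \<open>The row sum is the covariance of one increment with the total increment from
      \<open>t k\<close> to \<open>t 0\<close>. It consists of one drop of \<open>heat_cov\<close>
      for each side of the interval, all at distances at most \<open>l\<close>; the bound from one
      side is kept.\<close>
    also have "\<dots> = (heat_cov \<bar>t i - t 0\<bar> - heat_cov \<bar>t (Suc i) - t 0\<bar>) - (heat_cov \<bar>t i - t k\<bar> - heat_cov \<bar>t (Suc i) - t k\<bar>)"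
      by (rule sum_lessThan_telescope')
    also have "\<dots> = (heat_cov (t 0 - t i) - heat_cov ((t 0 - t i) + (t i - t (Suc i))))
       + (heat_cov (t (Suc i) - t k) - heat_cov ((t (Suc i) - t k) + (t i - t (Suc i))))"
      using o by simp
    also have "\<dots> \<ge> gauss_tail (l / sqrt 2) * (t i - t (Suc i)) + gauss_tail (l / sqrt 2) * (t i - t (Suc i))"
      using o l by (intro add_mono heat_cov_decrease) auto
    also have "gauss_tail (l / sqrt 2) * (t i - t (Suc i)) + gauss_tail (l / sqrt 2) * (t i - t (Suc i)) \<ge> gauss_tail (l / sqrt 2) * (t i - t (Suc i))"
      using o gauss_tail_pos[of "l / sqrt 2"] by simp
    finally show "gauss_tail (l / sqrt 2) * (t i - t (Suc i)) \<le> (\<Sum>j<k. G i j)" by simp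
  qed
  finally show ?thesis by (simp add: sum_distrib_left mult_ac)
qed

section \<open>The solution as a Gaussian process\<close>

lemma borel_measurable_cis [measurable (raw)]:
  "f \<in> borel_measurable N \<Longrightarrow> (\<lambda>x. cis (f x)) \<in> borel_measurable N"
  by (rule measurable_compose) (auto intro!: borel_measurable_continuous_onI continuous_intros)

text \<open>Standardising reduces this to the known characteristic function of the standard normal
  law. The degenerate case is separate, as it has no density.\<close>

lemma (in prob_space) expectation_cis_centered_gaussian:
  assumes "centered_gaussian M X"
  shows "(\<integral>\<omega>. cis (X \<omega>) \<partial>M) = complex_of_real (exp (- (\<integral>\<omega>. (X \<omega>)\<^sup>2 \<partial>M) / 2))"
proof -
  have X [measurable]: "X \<in> borel_measurable M"
    using assms by (simp add: centered_gaussian_def)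
  consider "AE \<omega> in M. X \<omega> = 0" | \<sigma> where "\<sigma> > 0" "distributed M lborel X (\<lambda>x. ennreal (normal_density 0 \<sigma> x))"
    using assms by (auto simp: centered_gaussian_def)
  then show ?thesis
  proof cases
    case 1
    have "(\<integral>\<omega>. cis (X \<omega>) \<partial>M) = (\<integral>\<omega>. 1 \<partial>M)"
      by (rule integral_cong_AE) (use 1 in auto)
    moreover have "(\<integral>\<omega>. (X \<omega>)\<^sup>2 \<partial>M) = (\<integral>\<omega>. 0 \<partial>M)"
      by (rule integral_cong_AE) (use 1 in auto)
    ultimately show ?thesis by (simp add: prob_space)
  next
    case 2
    have var: "(\<integral>\<omega>. (X \<omega>)\<^sup>2 \<partial>M) = \<sigma>\<^sup>2"
      using normal_distributed_variance[OF 2] normal_distributed_expectation[OF 2] by simp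
    have Z: "distributed M lborel (\<lambda>\<omega>. X \<omega> / \<sigma>) std_normal_density"
      using 2 normal_standard_normal_convert[of \<sigma> X 0] by simp
    have "(\<integral>\<omega>. cis (X \<omega>) \<partial>M) = (\<integral>\<omega>. iexp (\<sigma> * (X \<omega> / \<sigma>)) \<partial>M)"
      using 2 by (simp add: cis_conv_exp)
    also have "\<dots> = (\<integral>y. iexp (\<sigma> * y) \<partial>distr M lborel (\<lambda>\<omega>. X \<omega> / \<sigma>))"
      by (rule integral_distr[symmetric]) auto
    also have "\<dots> = char std_normal_distribution \<sigma>"
      using distributed_distr_eq_density[OF Z] by (simp add: char_def)
    finally show ?thesis by (simp add: var char_std_normal_distribution)
  qed
qed

locale heat_solution = prob_space M for M :: "'a measure" +
  fixes W :: "(real \<times> real \<Rightarrow> real) \<Rightarrow> 'a \<Rightarrow> real"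
    and x :: "real \<Rightarrow> 'a \<Rightarrow> real" and U1 U2 :: real
  assumes U: "U1 < U2"
    and noise: "space_time_white_noise M W"
    and version: "heat_solution_version M W {U1..U2} x"
begin

text \<open>Extending \<open>x\<close> by constants outside of \<open>[U1, U2]\<close> gives a continuous process on the whole line.\<close>

definition X :: "real \<Rightarrow> 'a \<Rightarrow> real" where
  "X s \<omega> = x (max U1 (min U2 s)) \<omega>"

definition Y :: "real \<Rightarrow> 'a \<Rightarrow> real" where
  "Y s \<omega> = X s \<omega> - X U1 \<omega>"

text \<open>The smallest value of the negative slope of \<open>heat_cov\<close> on distances up to
  \<open>U2 - U1\<close>, attained at the largest distance. It is positive because the interval is
  bounded.\<close>

definition c :: real where
  "c = gauss_tail ((U2 - U1) / sqrt 2)"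

lemma c_pos: "c > 0"
  by (simp add: c_def gauss_tail_pos)

lemma X_eq: "s \<in> {U1..U2} \<Longrightarrow> X s \<omega> = x s \<omega>"
  by (cases "s = U2") (simp_all add: X_def min_def max_def)

lemma borel_measurable_X_at: "X s \<in> borel_measurable M"
  using version U unfolding X_def[abs_def] heat_solution_version_def by auto

lemma continuous_X: "\<omega> \<in> space M \<Longrightarrow> continuous_on S (\<lambda>s. X s \<omega>)"
proof -
  assume "\<omega> \<in> space M"
  then have "continuous_on {U1..U2} (\<lambda>u. x u \<omega>)"
    using version unfolding heat_solution_version_def by auto
  then show ?thesis
    unfolding X_def
    by (rule continuous_on_compose2) (use U in \<open>auto intro!: continuous_intros\<close>)
qed

text \<open>Rounding the time down to a grid of mesh \<open>1 / Suc n\<close> leaves countably many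
  times, hence a jointly measurable function, and continuity of the paths gives the limit. Rounded
  times may leave \<open>[U1, U2]\<close>, which the constant extension permits.\<close>

lemma borel_measurable_X [measurable]: "(\<lambda>(s, \<omega>). X s \<omega>) \<in> borel_measurable (borel \<Otimes>\<^sub>M M)"
proof (rule borel_measurable_LIMSEQ_real)
  fix n :: nat
  have "(\<lambda>p :: real \<times> 'a. \<lfloor>real (Suc n) * fst p\<rfloor>) \<in> borel \<Otimes>\<^sub>M M \<rightarrow>\<^sub>M count_space UNIV"
    by measurable
  then show "(\<lambda>p :: real \<times> 'a. X (real_of_int \<lfloor>real (Suc n) * fst p\<rfloor> / real (Suc n)) (snd p)) \<in> borel_measurable (borel \<Otimes>\<^sub>M M)"
    by (rule measurable_compose_countable[rotated]) (rule measurable_compose[OF measurable_snd borel_measurable_X_at])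
next
  fix p :: "real \<times> 'a" assume p: "p \<in> space (borel \<Otimes>\<^sub>M M)"
  have "(\<lambda>n. real_of_int \<lfloor>real (Suc n) * fst p\<rfloor> / real (Suc n)) \<longlonglongrightarrow> fst p"
  proof (rule LIM_zero_cancel, rule Lim_null_comparison)
    show "(\<lambda>n. 1 / real (Suc n)) \<longlonglongrightarrow> 0"
      by (rule LIMSEQ_Suc[OF lim_1_over_n])
    have "norm (real_of_int \<lfloor>real (Suc n) * fst p\<rfloor> / real (Suc n) - fst p) \<le> 1 / real (Suc n)" for n
    proof -
      have "norm (real_of_int \<lfloor>real (Suc n) * fst p\<rfloor> / real (Suc n) - fst p)
        = \<bar>real_of_int \<lfloor>real (Suc n) * fst p\<rfloor> - real (Suc n) * fst p\<bar> / real (Suc n)"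
        by (simp add: field_simps)
      also have "\<dots> \<le> 1 / real (Suc n)"
        by (intro divide_right_mono) linarith+
      finally show ?thesis .
    qed
    then show "\<forall>\<^sub>F n in sequentially. norm (real_of_int \<lfloor>real (Suc n) * fst p\<rfloor> / real (Suc n) - fst p) \<le> 1 / real (Suc n)"
      by (intro always_eventually allI)
  qed
  moreover have "isCont (\<lambda>s. X s (snd p)) (fst p)"
    using continuous_X[of "snd p" UNIV] p by (simp add: space_pair_measure continuous_on_eq_continuous_at mem_Times_iff)
  ultimately have "(\<lambda>n. X (real_of_int \<lfloor>real (Suc n) * fst p\<rfloor> / real (Suc n)) (snd p)) \<longlonglongrightarrow> X (fst p) (snd p)"
    by (rule isCont_tendsto_compose[rotated])
  then show "(\<lambda>n. X (real_of_int \<lfloor>real (Suc n) * fst p\<rfloor> / real (Suc n)) (snd p)) \<longlonglongrightarrow> (case p of (s, \<omega>) \<Rightarrow> X s \<omega>)"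
    by (simp add: case_prod_unfold)
qed

lemma borel_measurable_X_comp [measurable (raw)]:
  "f \<in> borel_measurable N \<Longrightarrow> g \<in> measurable N M \<Longrightarrow> (\<lambda>x. X (f x) (g x)) \<in> borel_measurable N"
  using measurable_compose[OF measurable_Pair borel_measurable_X, of f N g] by simp

lemma borel_measurable_Y_comp [measurable (raw)]:
  "f \<in> borel_measurable N \<Longrightarrow> g \<in> measurable N M \<Longrightarrow> (\<lambda>x. Y (f x) (g x)) \<in> borel_measurable N"
  unfolding Y_def by (intro borel_measurable_diff borel_measurable_X_comp borel_measurable_const)

section \<open>Characteristic functions of combinations of increments\<close>

lemma W_lincomb:
  "f \<in> L2_strip \<Longrightarrow> g \<in> L2_strip \<Longrightarrow> AE \<omega> in M. W (\<lambda>z. a * f z + b * g z) \<omega> = a * W f \<omega> + b * W g \<omega>"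
  using noise by (simp add: space_time_white_noise_def)

lemma expectation_cis_W:
  assumes "h \<in> L2_strip"
  shows "(\<integral>\<omega>. cis (W h \<omega>) \<partial>M) = complex_of_real (exp (- (\<integral>z. (h z)\<^sup>2 \<partial>strip) / 2))"
proof -
  have "centered_gaussian M (\<lambda>\<omega>. \<Sum>j\<in>{h}. 1 * W j \<omega>)"
    using noise assms unfolding space_time_white_noise_def centered_gaussian_family_def
    by (elim conjE allE[of _ "{h}"] allE[of _ "\<lambda>_. 1"]) auto
  then show ?thesis
    using expectation_cis_centered_gaussian[of "W h"] noise assms by (simp add: space_time_white_noise_def)
qed

definition H :: "nat \<Rightarrow> (nat \<Rightarrow> real) \<Rightarrow> (nat \<Rightarrow> real) \<Rightarrow> 'a \<Rightarrow> real" where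
  "H k \<mu> t \<omega> = (\<Sum>j<k. \<mu> j * (X (t j) \<omega> - X (t (Suc j)) \<omega>))"

lemma borel_measurable_H [measurable]: "H k \<mu> t \<in> borel_measurable M"
  unfolding H_def[abs_def] by measurable

text \<open>Linearity of the noise is an almost sure statement about two functions at a time, so the
  sum is built up by induction, with finitely many null sets discarded on the way.\<close>

lemma H_eq_W:
  assumes "\<And>j. j \<le> k \<Longrightarrow> t j \<in> {U1..U2}"
  shows "increments k \<mu> t \<in> L2_strip \<and> (AE \<omega> in M. H k \<mu> t \<omega> = W (increments k \<mu> t) \<omega>)"
  using assms
proof (induction k)
  case 0
  \<comment> \<open>Writing the zero function as a trivial combination lets linearity show that its
    stochastic integral vanishes almost surely.\<close>
  have "increments 0 \<mu> t = (\<lambda>z. 0 * green 0 z + 0 * green 0 z)"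
    by (simp add: increments_def fun_eq_iff)
  then show ?case
    using L2_strip_lincomb[OF L2_strip_green L2_strip_green, of 0 0 0 0]
      W_lincomb[OF L2_strip_green L2_strip_green, of 0 0 0 0]
    by (simp add: H_def)
next
  case (Suc k)
  define g where "g z = 1 * green (t k) z + (- 1) * green (t (Suc k)) z" for z
  have g: "g \<in> L2_strip"
    unfolding g_def by (intro L2_strip_lincomb L2_strip_green)
  have X: "AE \<omega> in M. X (t j) \<omega> = W (green (t j)) \<omega>" if "j \<le> Suc k" for j
    using version Suc.prems[OF that] by (simp add: heat_solution_version_def X_eq)
  have IH: "increments k \<mu> t \<in> L2_strip" "AE \<omega> in M. H k \<mu> t \<omega> = W (increments k \<mu> t) \<omega>"
    using Suc by auto
  have e: "increments (Suc k) \<mu> t = (\<lambda>z. 1 * increments k \<mu> t z + \<mu> k * g z)"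
    by (simp add: increments_def g_def fun_eq_iff)
  have "AE \<omega> in M. W g \<omega> = 1 * W (green (t k)) \<omega> + (- 1) * W (green (t (Suc k))) \<omega>"
    unfolding g_def by (intro W_lincomb L2_strip_green)
  with W_lincomb[OF IH(1) g, of 1 "\<mu> k"] IH(2) X[of k] X[of "Suc k"]
  have "AE \<omega> in M. H (Suc k) \<mu> t \<omega> = W (increments (Suc k) \<mu> t) \<omega>"
    unfolding e by (auto simp: H_def)
  then show ?case
    using L2_strip_lincomb[OF IH(1) g, of 1 "\<mu> k"] unfolding e by blast
qed

text \<open>The characteristic function is the exponential of minus half the variance, and local
  nondeterminism bounds the variance from below. All times lie in \<open>[U1, U2]\<close>, so
  \<open>U2 - U1\<close> bounds their spread and \<open>c\<close> is the constant.\<close>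

lemma expectation_cis_H_le:
  assumes t: "\<And>j. j < k \<Longrightarrow> t (Suc j) \<le> t j" "t 0 \<le> U2" "U1 \<le> t k"
  shows "norm (\<integral>\<omega>. cis (H k \<mu> t \<omega>) \<partial>M) \<le> exp (- (c / 2) * (\<Sum>j<k. (\<mu> j)\<^sup>2 * (t j - t (Suc j))))"
proof -
  have "t j \<in> {U1..U2}" if "j \<le> k" for j
    using antitone_upto[of k t 0 j] antitone_upto[of k t j k] t that by force
  note h = H_eq_W[of k t \<mu>, OF this]
  then have "(\<integral>\<omega>. cis (H k \<mu> t \<omega>) \<partial>M) = (\<integral>\<omega>. cis (W (increments k \<mu> t) \<omega>) \<partial>M)"
    using noise by (intro integral_cong_AE borel_measurable_cis borel_measurable_H)
     (auto simp: space_time_white_noise_def centered_gaussian_family_def centered_gaussian_def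
       dest!: spec[of _ "{increments k \<mu> t}"] spec[of _ "\<lambda>_. 1"])
  also have "norm \<dots> = exp (- (\<integral>z. (increments k \<mu> t z)\<^sup>2 \<partial>strip) / 2)"
    using h by (simp add: expectation_cis_W)
  also have "\<dots> \<le> exp (- (c / 2) * (\<Sum>j<k. (\<mu> j)\<^sup>2 * (t j - t (Suc j))))"
    using increments_norm_ge[of k t "U2 - U1" \<mu>] t by (simp add: c_def)
  finally show ?thesis .
qed

end

section \<open>Iterated Gaussian integrals\<close>

text \<open>
  Bounds the contribution of \<open>n\<close> times in \<open>[a, t]\<close>, when \<open>\<xi>\<close> is the sum of the
  frequencies attached to the times in \<open>[t, \<infinity>)\<close>.
\<close>

primrec lt_bound :: "real \<Rightarrow> real \<Rightarrow> nat \<Rightarrow> real \<Rightarrow> real \<Rightarrow> ennreal" where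
  "lt_bound c a 0 = (\<lambda>\<xi> t. ennreal (exp (- (c / 2) * (\<xi>\<^sup>2 * (t - a)))))"
| "lt_bound c a (Suc n) = (\<lambda>\<xi> t. \<integral>\<^sup>+ s \<in> {a..t}. ennreal (exp (- (c / 2) * (\<xi>\<^sup>2 * (t - s)))) *
      (\<integral>\<^sup>+ \<eta>. ennreal (1 / (2 * pi)) * lt_bound c a n \<eta> s \<partial>lborel) \<partial>lborel)"

lemma borel_measurable_lt_bound:
  "(\<lambda>(\<xi>, t). lt_bound c a n \<xi> t) \<in> borel_measurable (borel \<Otimes>\<^sub>M borel)"
proof (induction n)
  case (Suc n)
  have [measurable (raw)]: "(\<lambda>x. lt_bound c a n (f x) (g x)) \<in> borel_measurable N"
    if "f \<in> borel_measurable N" "g \<in> borel_measurable N" for f g and N :: "'c measure"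
    using measurable_compose[OF measurable_Pair Suc, OF that] by simp
  have ind: "indicator {a..t} s = (if a \<le> s \<and> s \<le> t then 1 else 0 :: ennreal)" for s t :: real
    by (simp add: indicator_def)
  show ?case unfolding lt_bound.simps ind by measurable
qed simp

lemma borel_measurable_lt_bound_comp [measurable (raw)]:
  "f \<in> borel_measurable N \<Longrightarrow> g \<in> borel_measurable N \<Longrightarrow> (\<lambda>x. lt_bound c a n (f x) (g x)) \<in> borel_measurable N"
  using measurable_compose[OF measurable_Pair borel_measurable_lt_bound, of f N g] by simp

text \<open>The frequency integral is \<open>sqrt (2 * pi / c) / sqrt r\<close>, whose singularity
  at 0 is integrable with primitive \<open>2 * sqrt r\<close>. This integrability is what makes a
  local time possible.\<close>

lemma nn_integral_gaussian_time:
  fixes c l :: real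
  assumes c: "c > 0" and l: "l \<ge> 0"
  shows "(\<integral>\<^sup>+ r \<in> {0..l}. (\<integral>\<^sup>+ \<xi>. ennreal (exp (- (c / 2) * (\<xi>\<^sup>2 * r))) \<partial>lborel) \<partial>lborel) < \<infinity>"
proof -
  have g: "(\<integral>\<^sup>+ \<xi>. ennreal (exp (- (c / 2) * (\<xi>\<^sup>2 * r))) \<partial>lborel) = ennreal (sqrt (2 * pi / c) * (1 / sqrt r))" if "r > 0" for r
  proof -
    have e: "exp (- (c / 2) * (\<xi>\<^sup>2 * r)) = sqrt (2 * pi / c) * (1 / sqrt r) * normal_density 0 (1 / sqrt (c * r)) \<xi>" for \<xi>
      using c that by (simp add: normal_density_def real_sqrt_divide real_sqrt_mult power_divide field_simps)
    have "(\<integral>\<^sup>+ \<xi>. ennreal (exp (- (c / 2) * (\<xi>\<^sup>2 * r))) \<partial>lborel) = ennreal (\<integral>\<xi>. exp (- (c / 2) * (\<xi>\<^sup>2 * r)) \<partial>lborel)"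
      unfolding e using c that by (intro nn_integral_eq_integral) (auto intro!: AE_I2)
    also have "(\<integral>\<xi>. exp (- (c / 2) * (\<xi>\<^sup>2 * r)) \<partial>lborel) = sqrt (2 * pi / c) * (1 / sqrt r)"
      unfolding e using c that by simp
    finally show ?thesis .
  qed
  have "((\<lambda>r. sqrt (2 * pi / c) * (1 / sqrt r)) has_integral sqrt (2 * pi / c) * (2 * sqrt l) - sqrt (2 * pi / c) * (2 * sqrt 0)) {0..l}"
  proof (rule fundamental_theorem_of_calculus_interior[OF l])
    fix r assume "r \<in> {0<..<l}"
    then have "((\<lambda>r. sqrt (2 * pi / c) * (2 * sqrt r)) has_real_derivative sqrt (2 * pi / c) * (1 / sqrt r)) (at r)"
      by (intro DERIV_cmult) (auto intro!: derivative_eq_intros simp: field_simps)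
    then show "((\<lambda>r. sqrt (2 * pi / c) * (2 * sqrt r)) has_vector_derivative sqrt (2 * pi / c) * (1 / sqrt r)) (at r)"
      by (simp only: has_real_derivative_iff_has_vector_derivative)
  qed (intro continuous_intros)
  then obtain I where "((\<lambda>r. sqrt (2 * pi / c) * (1 / sqrt r)) has_integral I) {0..l}" by blast
  then have "((\<lambda>r. if r \<in> {0..l} then sqrt (2 * pi / c) * (1 / sqrt r) else 0) has_integral I) UNIV"
    by (simp only: has_integral_restrict_UNIV)
  then have I: "(\<integral>\<^sup>+ r. ennreal (if r \<in> {0..l} then sqrt (2 * pi / c) * (1 / sqrt r) else 0) \<partial>lborel) = ennreal I"
    using c by (intro nn_integral_has_integral_lborel) auto
  have "(\<integral>\<^sup>+ r \<in> {0..l}. (\<integral>\<^sup>+ \<xi>. ennreal (exp (- (c / 2) * (\<xi>\<^sup>2 * r))) \<partial>lborel) \<partial>lborel)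
     = (\<integral>\<^sup>+ r. ennreal (if r \<in> {0..l} then sqrt (2 * pi / c) * (1 / sqrt r) else 0) \<partial>lborel)"
  \<comment> \<open>The point \<open>r = 0\<close> has to be excluded: there the frequency integral
    is infinite, whereas \<open>1 / sqrt 0\<close> is 0.\<close>
  proof (rule nn_integral_cong_AE)
    show "AE r in lborel. (\<integral>\<^sup>+ \<xi>. ennreal (exp (- (c / 2) * (\<xi>\<^sup>2 * r))) \<partial>lborel) * indicator {0..l} r
       = ennreal (if r \<in> {0..l} then sqrt (2 * pi / c) * (1 / sqrt r) else 0)"
      using AE_lborel_singleton[of "0 :: real"]
    proof eventually_elim
      case (elim r)
      then show ?case using g[of r] by (cases "r \<in> {0..l}") auto
    qed
  qed
  then show ?thesis using I by simp
qed

text \<open>By Tonelli the latest time \<open>t\<close> and its frequency are integrated first with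
  the next time \<open>s\<close> fixed. Only the gap \<open>t - s\<close> matters, and it
  contributes at most \<open>\<kappa>\<close> uniformly in \<open>s\<close>, so each step of the
  induction costs a factor \<open>\<kappa>\<close>.\<close>

lemma nn_integral_lt_bound_finite:
  assumes c: "c > 0"
  shows "(\<integral>\<^sup>+ t \<in> {a..b}. (\<integral>\<^sup>+ \<xi>. ennreal (1 / (2 * pi)) * lt_bound c a n \<xi> t \<partial>lborel) \<partial>lborel) < \<infinity>"
proof (cases "a \<le> b")
  case True
  define q where "q r = (\<integral>\<^sup>+ \<xi>. ennreal (1 / (2 * pi)) * ennreal (exp (- (c / 2) * (\<xi>\<^sup>2 * r))) \<partial>lborel)" for r
  have [measurable]: "q \<in> borel_measurable borel"
    unfolding q_def by measurable
  define \<kappa> where "\<kappa> = (\<integral>\<^sup>+ r \<in> {0..b - a}. q r \<partial>lborel)"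
  have "\<kappa> = ennreal (1 / (2 * pi)) * (\<integral>\<^sup>+ r \<in> {0..b - a}. (\<integral>\<^sup>+ \<xi>. ennreal (exp (- (c / 2) * (\<xi>\<^sup>2 * r))) \<partial>lborel) \<partial>lborel)"
    unfolding \<kappa>_def q_def by (subst nn_integral_cmult[symmetric]) (auto simp: nn_integral_cmult mult.assoc)
  then have \<kappa>: "\<kappa> < \<infinity>"
    using nn_integral_gaussian_time[OF c, of "b - a"] True by (simp add: ennreal_mult_less_top)
  have shift: "(\<integral>\<^sup>+ t. indicator {s..b} t * q (t - s) \<partial>lborel) \<le> \<kappa>" if "a \<le> s" for s
  proof -
    have "(\<integral>\<^sup>+ t. indicator {s..b} t * q (t - s) \<partial>lborel) = (\<integral>\<^sup>+ r. indicator {s..b} (s + 1 * r) * q ((s + 1 * r) - s) \<partial>lborel)"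
      by (subst nn_integral_real_affine[where c=1 and t=s]) auto
    also have "\<dots> \<le> \<kappa>"
      unfolding \<kappa>_def using that by (intro nn_integral_mono) (auto simp: indicator_def)
    finally show ?thesis .
  qed
  show ?thesis
  proof (induction n)
    case 0
    have "(\<integral>\<^sup>+ t \<in> {a..b}. (\<integral>\<^sup>+ \<xi>. ennreal (1 / (2 * pi)) * lt_bound c a 0 \<xi> t \<partial>lborel) \<partial>lborel) \<le> \<kappa>"
      using shift[of a] by (simp add: q_def mult.commute)
    then show ?case using \<kappa> by (rule le_less_trans)
  next
    case (Suc n)
    define A where "A s = (\<integral>\<^sup>+ \<eta>. ennreal (1 / (2 * pi)) * lt_bound c a n \<eta> s \<partial>lborel)" for s
    have [measurable]: "A \<in> borel_measurable borel"
      unfolding A_def by measurable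
    have ind: "indicator {a..t} s = (if a \<le> s \<and> s \<le> t then 1 else 0 :: ennreal)" for s t :: real
      by (simp add: indicator_def)
    have "(\<integral>\<^sup>+ \<xi>. ennreal (1 / (2 * pi)) * lt_bound c a (Suc n) \<xi> t \<partial>lborel)
       = (\<integral>\<^sup>+ s. indicator {a..t} s * A s * q (t - s) \<partial>lborel)" for t
    proof -
      have "(\<integral>\<^sup>+ \<xi>. ennreal (1 / (2 * pi)) * lt_bound c a (Suc n) \<xi> t \<partial>lborel)
         = (\<integral>\<^sup>+ \<xi>. (\<integral>\<^sup>+ s. (indicator {a..t} s * A s) * (ennreal (1 / (2 * pi)) * ennreal (exp (- (c / 2) * (\<xi>\<^sup>2 * (t - s))))) \<partial>lborel) \<partial>lborel)"
        unfolding A_def[symmetric] lt_bound.simps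
        by (subst nn_integral_cmult[symmetric]) (auto simp: mult_ac intro!: nn_integral_cong)
      also have "\<dots> = (\<integral>\<^sup>+ s. (\<integral>\<^sup>+ \<xi>. (indicator {a..t} s * A s) * (ennreal (1 / (2 * pi)) * ennreal (exp (- (c / 2) * (\<xi>\<^sup>2 * (t - s))))) \<partial>lborel) \<partial>lborel)"
        by (rule lborel_pair.Fubini') measurable
      also have "\<dots> = (\<integral>\<^sup>+ s. indicator {a..t} s * A s * q (t - s) \<partial>lborel)"
        unfolding q_def by (intro nn_integral_cong nn_integral_cmult) measurable
      finally show ?thesis .
    qed
    then have "(\<integral>\<^sup>+ t \<in> {a..b}. (\<integral>\<^sup>+ \<xi>. ennreal (1 / (2 * pi)) * lt_bound c a (Suc n) \<xi> t \<partial>lborel) \<partial>lborel)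
       = (\<integral>\<^sup>+ t. (\<integral>\<^sup>+ s. indicator {a..b} t * (indicator {a..t} s * A s * q (t - s)) \<partial>lborel) \<partial>lborel)"
      by (auto simp: nn_integral_cmult[symmetric] mult.commute intro!: nn_integral_cong)
    also have "\<dots> = (\<integral>\<^sup>+ s. (\<integral>\<^sup>+ t. indicator {a..b} t * (indicator {a..t} s * A s * q (t - s)) \<partial>lborel) \<partial>lborel)"
      unfolding ind by (rule lborel_pair.Fubini') measurable
    also have "\<dots> \<le> (\<integral>\<^sup>+ s. \<kappa> * (A s * indicator {a..b} s) \<partial>lborel)"
    proof (rule nn_integral_mono)
      fix s :: real
      have "(\<integral>\<^sup>+ t. indicator {a..b} t * (indicator {a..t} s * A s * q (t - s)) \<partial>lborel)
        = (\<integral>\<^sup>+ t. A s * indicator {a..b} s * (indicator {s..b} t * q (t - s)) \<partial>lborel)"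
        by (intro nn_integral_cong) (auto simp: indicator_def)
      also have "\<dots> = A s * indicator {a..b} s * (\<integral>\<^sup>+ t. indicator {s..b} t * q (t - s) \<partial>lborel)"
        by (rule nn_integral_cmult) measurable
      also have "\<dots> \<le> \<kappa> * (A s * indicator {a..b} s)"
        using mult_left_mono[OF shift[of s], of "A s"] by (cases "s \<in> {a..b}") (simp_all add: mult.commute)
      finally show "(\<integral>\<^sup>+ t. indicator {a..b} t * (indicator {a..t} s * A s * q (t - s)) \<partial>lborel)
         \<le> \<kappa> * (A s * indicator {a..b} s)" .
    qed
    also have "\<dots> = \<kappa> * (\<integral>\<^sup>+ s \<in> {a..b}. A s \<partial>lborel)"
      by (rule nn_integral_cmult) measurable
    also have "\<dots> < \<infinity>"
      using \<kappa> Suc unfolding A_def by (simp add: ennreal_mult_less_top)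
    finally show ?case .
  qed
qed simp

section \<open>Moments of occupation integrals\<close>

text \<open>Here \<open>f\<close> stands for the difference of two smoothed point masses at
  \<open>z\<close>, and \<open>w\<close> for its weight in frequency space. Integrability of
  \<open>w\<close> and the bound \<open>B\<close> justify exchanging integrals for a fixed pair of
  smoothing parameters; the moment estimates see \<open>w\<close> only through its absolute value
  and the bound 1, hence are uniform in these parameters.\<close>

locale fourier_test = heat_solution M W x U1 U2
  for M :: "'a measure" and W :: "(real \<times> real \<Rightarrow> real) \<Rightarrow> 'a \<Rightarrow> real"
    and x :: "real \<Rightarrow> 'a \<Rightarrow> real" and U1 U2 :: real +
  fixes f w :: "real \<Rightarrow> real" and z B :: real
  assumes w_integrable: "integrable lborel w"
    and w_le: "\<And>\<xi>. \<bar>w \<xi>\<bar> \<le> 1"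
    and fourier: "\<And>y. (\<integral>\<xi>. complex_of_real (w \<xi>) * cis (\<xi> * (y - z)) \<partial>lborel) = complex_of_real (2 * pi * f y)"
    and f_cont: "continuous_on UNIV f"
    and f_le: "\<And>y. \<bar>f y\<bar> \<le> B"
begin

lemma borel_measurable_w [measurable]: "w \<in> borel_measurable borel"
  using w_integrable by (auto dest: borel_measurable_integrable)

lemma borel_measurable_f [measurable]: "f \<in> borel_measurable borel"
  by (rule borel_measurable_continuous_onI[OF f_cont])

definition G :: "real \<Rightarrow> 'a \<Rightarrow> real" where
  "G t \<omega> = (LINT s:{U1..t}|lborel. f (Y s \<omega>))"

text \<open>
  \<open>J n t\<close> is the integral of \<open>f (Y s\<^sub>1) \<cdots> f (Y s\<^sub>n)\<close> over \<open>U1 \<le> s\<^sub>1 \<le> \<dots> \<le> s\<^sub>n \<le> t\<close>.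
\<close>

definition J :: "nat \<Rightarrow> real \<Rightarrow> 'a \<Rightarrow> real" where
  "J n t \<omega> = G t \<omega> ^ n / fact n"

lemma J_0 [simp]: "J 0 t \<omega> = 1"
  by (simp add: J_def)

lemma continuous_f_Y: "\<omega> \<in> space M \<Longrightarrow> continuous_on S (\<lambda>s. f (Y s \<omega>))"
  unfolding Y_def by (intro continuous_on_compose2[OF f_cont] continuous_intros continuous_X) auto

lemma set_lebesgue_integral_continuous:
  fixes g :: "real \<Rightarrow> real"
  assumes "continuous_on {a..b} g"
  shows "(LINT s:{a..b}|lborel. g s) = integral {a..b} g"
  by (intro set_borel_integral_eq_integral borel_integrable_atLeastAtMost' assms)

lemma J_DERIV:
  assumes \<omega>: "\<omega> \<in> space M" and s: "s \<in> {U1..t}"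
  shows "((\<lambda>s. J (Suc n) s \<omega>) has_real_derivative f (Y s \<omega>) * J n s \<omega>) (at s within {U1..t})"
proof -
  have "((\<lambda>s. integral {U1..s} (\<lambda>s. f (Y s \<omega>))) has_real_derivative f (Y s \<omega>)) (at s within {U1..t})"
    by (rule integral_has_real_derivative[OF continuous_f_Y[OF \<omega>] s])
  then have "((\<lambda>s. G s \<omega>) has_real_derivative f (Y s \<omega>)) (at s within {U1..t})"
    by (simp add: G_def set_lebesgue_integral_continuous continuous_f_Y[OF \<omega>])
  then show ?thesis
    unfolding J_def
    by (rule DERIV_cong[OF DERIV_cdivide[OF DERIV_power[where n="Suc n"]]])
      (simp add: field_simps del: of_nat_Suc)
qed

text \<open>The derivative of a power divided by its factorial reproduces the recursion of ordered
  integrals in their largest time. Working with powers of \<open>G\<close> thus replaces integrals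
  over simplices by the fundamental theorem of calculus.\<close>

lemma J_Suc:
  assumes \<omega>: "\<omega> \<in> space M" and t: "U1 \<le> t"
  shows "J (Suc n) t \<omega> = (LINT s:{U1..t}|lborel. f (Y s \<omega>) * J n s \<omega>)"
proof -
  have "((\<lambda>s. f (Y s \<omega>) * J n s \<omega>) has_integral J (Suc n) t \<omega> - J (Suc n) U1 \<omega>) {U1..t}"
    using J_DERIV[OF \<omega>] t
    by (intro fundamental_theorem_of_calculus) (auto simp: has_real_derivative_iff_has_vector_derivative)
  moreover have "J (Suc n) U1 \<omega> = 0"
    unfolding J_def G_def by (subst set_lebesgue_integral_continuous[OF continuous_f_Y[OF \<omega>]]) simp
  moreover have "continuous_on {U1..t} (\<lambda>s. J n s \<omega>)"
  proof (cases n)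
    case (Suc m)
    show ?thesis
      unfolding Suc by (rule DERIV_continuous_on[OF J_DERIV[OF \<omega>]])
  qed simp
  ultimately show ?thesis
    by (subst set_lebesgue_integral_continuous)
      (auto simp: integral_unique intro!: continuous_on_mult continuous_f_Y[OF \<omega>])
qed

section \<open>Moment bounds by peeling off the latest time\<close>

lemma borel_measurable_J [measurable (raw)]:
  assumes g: "g \<in> borel_measurable N" and h: "h \<in> measurable N M"
  shows "(\<lambda>y. J n (g y) (h y)) \<in> borel_measurable N"
proof -
  have ind: "indicator {U1..t} s = (if U1 \<le> s \<and> s \<le> t then 1 else 0 :: real)" for s t :: real
    by (simp add: indicator_def)
  have "(\<lambda>(t, \<omega>). G t \<omega>) \<in> borel_measurable (borel \<Otimes>\<^sub>M M)"
    unfolding G_def set_lebesgue_integral_def ind by measurable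
  from measurable_compose[OF measurable_Pair this, OF g h] show ?thesis
    unfolding J_def by simp
qed

lemma B_nonneg: "0 \<le> B"
  using f_le[of 0] by simp

text \<open>A crude bound, not uniform in the smoothing because \<open>B\<close> is not; it serves
  as the domination in Fubini's theorem.\<close>

lemma J_bounded:
  assumes "\<omega> \<in> space M" "U1 \<le> t" "t \<le> U2"
  shows "\<bar>J n t \<omega>\<bar> \<le> (B * (U2 - U1)) ^ n"
proof -
  have "\<bar>G t \<omega>\<bar> \<le> B * (t - U1)"
    using integral_bound[of U1 t "\<lambda>s. f (Y s \<omega>)" B] assms f_le continuous_f_Y
    by (simp add: G_def set_lebesgue_integral_continuous)
  also have "\<dots> \<le> B * (U2 - U1)"
    using assms B_nonneg by (intro mult_left_mono) auto
  finally have "\<bar>G t \<omega>\<bar> ^ n \<le> (B * (U2 - U1)) ^ n"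
    by (intro power_mono) auto
  moreover have "\<bar>J n t \<omega>\<bar> \<le> \<bar>G t \<omega>\<bar> ^ n"
    by (simp add: J_def power_abs divide_le_eq mult_left_le fact_ge_1 mult_le_cancel_left1)
  ultimately show ?thesis by simp
qed

text \<open>One factor \<open>f (Y s)\<close>, at the latest time, is replaced by its Fourier
  integral, and Fubini moves the expectation inside. The norm is then taken of the expectation and
  not of the integrand, which keeps the cancellation in \<open>cis\<close>.\<close>

lemma expectation_J_Suc_le:
  assumes A [measurable]: "A \<in> borel_measurable M" and t: "U1 \<le> t" "t \<le> U2"
  shows "ennreal (norm (\<integral>\<omega>. cis (A \<omega>) * complex_of_real (J (Suc n) t \<omega>) \<partial>M))
    \<le> (\<integral>\<^sup>+ s \<in> {U1..t}. (\<integral>\<^sup>+ \<xi>. ennreal (\<bar>w \<xi>\<bar> / (2 * pi)) *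
          ennreal (norm (\<integral>\<omega>. cis (A \<omega> + \<xi> * Y s \<omega>) * complex_of_real (J n s \<omega>) \<partial>M)) \<partial>lborel) \<partial>lborel)"
proof -
  define K where "K = (B * (U2 - U1)) ^ n"
  \<comment> \<open>The level enters only through the factor \<open>cis (- snd p * z)\<close> of
    modulus 1, which disappears in the norm; the resulting bound is uniform in
    \<open>z\<close>.\<close>
  define F where "F p \<omega> = complex_of_real (indicator {U1..t} (fst p) * (w (snd p) / (2 * pi))) * cis (- snd p * z) *
      (cis (A \<omega> + snd p * Y (fst p) \<omega>) * complex_of_real (J n (fst p) \<omega>))" for p :: "real \<times> real" and \<omega>
  interpret P: pair_sigma_finite "lborel :: (real \<times> real) measure" M ..
  have F [measurable]: "(\<lambda>(p, \<omega>). F p \<omega>) \<in> borel_measurable (lborel \<Otimes>\<^sub>M M)"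
    unfolding F_def lborel_prod[symmetric] by measurable
  have F_le: "norm (F p \<omega>) \<le> indicator {U1..t} (fst p) * (\<bar>w (snd p)\<bar> * K)" if "\<omega> \<in> space M" for p \<omega>
  proof (cases "fst p \<in> {U1..t}")
    case True
    have "\<bar>w (snd p)\<bar> * \<bar>J n (fst p) \<omega>\<bar> \<le> \<bar>w (snd p)\<bar> * K"
      using J_bounded[OF that, of "fst p" n] True t by (intro mult_left_mono) (auto simp: K_def)
    moreover have "\<bar>w (snd p)\<bar> * \<bar>J n (fst p) \<omega>\<bar> / (2 * pi) \<le> \<bar>w (snd p)\<bar> * \<bar>J n (fst p) \<omega>\<bar> / 1"
      using pi_gt3 by (intro divide_left_mono) auto
    ultimately show ?thesis using True by (simp add: F_def norm_mult norm_divide)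
  qed (simp add: F_def)
  have "(\<integral>\<^sup>+ q. ennreal (norm (case q of (p, \<omega>) \<Rightarrow> F p \<omega>)) \<partial>(lborel \<Otimes>\<^sub>M M))
     = (\<integral>\<^sup>+ p. (\<integral>\<^sup>+ \<omega>. ennreal (norm (F p \<omega>)) \<partial>M) \<partial>lborel)"
    by (subst nn_integral_fst[symmetric]) auto
  also have "\<dots> \<le> (\<integral>\<^sup>+ p. (\<integral>\<^sup>+ \<omega>. ennreal (indicator {U1..t} (fst p) * (\<bar>w (snd p)\<bar> * K)) \<partial>M) \<partial>lborel)"
    by (intro nn_integral_mono ennreal_leI F_le)
  also have "\<dots> = (\<integral>\<^sup>+ p. indicator {U1..t} (fst p) * (ennreal K * ennreal \<bar>w (snd p)\<bar>) \<partial>(lborel \<Otimes>\<^sub>M lborel))"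
    unfolding lborel_prod using B_nonneg U
    by (simp add: emeasure_space_1 ennreal_mult' ennreal_indicator[symmetric] K_def mult_ac)
  also have "\<dots> = (\<integral>\<^sup>+ s. (\<integral>\<^sup>+ \<xi>. indicator {U1..t} s * (ennreal K * ennreal \<bar>w \<xi>\<bar>) \<partial>lborel) \<partial>lborel)"
    by (subst lborel.nn_integral_fst[symmetric]) auto
  also have "\<dots> = (\<integral>\<^sup>+ s. (ennreal K * (\<integral>\<^sup>+ \<xi>. ennreal \<bar>w \<xi>\<bar> \<partial>lborel)) * indicator {U1..t} s \<partial>lborel)"
    by (intro nn_integral_cong) (simp add: nn_integral_cmult mult.commute)
  also have "\<dots> < \<infinity>"
    using w_integrable t by (simp add: nn_integral_cmult_indicator integrable_iff_bounded ennreal_mult_less_top emeasure_lborel_Icc)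
  finally have int: "integrable (lborel \<Otimes>\<^sub>M M) (\<lambda>(p, \<omega>). F p \<omega>)"
    by (intro integrableI_bounded F)
  have inner: "(\<integral>p. F p \<omega> \<partial>lborel) = cis (A \<omega>) * complex_of_real (J (Suc n) t \<omega>)"
    if \<omega>: "\<omega> \<in> space M" and i: "integrable lborel (\<lambda>p. F p \<omega>)" for \<omega>
  proof -
    have "(\<integral>p. F p \<omega> \<partial>lborel) = (\<integral>s. (\<integral>\<xi>. F (s, \<xi>) \<omega> \<partial>lborel) \<partial>lborel)"
      using lborel_pair.integral_fst'[of "\<lambda>p. F p \<omega>"] i by (simp add: lborel_prod)
    also have "\<dots> = (\<integral>s. cis (A \<omega>) * complex_of_real (indicator {U1..t} s *\<^sub>R (f (Y s \<omega>) * J n s \<omega>)) \<partial>lborel)"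
    proof (rule Bochner_Integration.integral_cong[OF refl])
      fix s
      have "F (s, \<xi>) \<omega> = (complex_of_real (indicator {U1..t} s * J n s \<omega> / (2 * pi)) * cis (A \<omega>)) *
         (complex_of_real (w \<xi>) * cis (\<xi> * (Y s \<omega> - z)))" for \<xi>
      proof -
        have "F (s, \<xi>) \<omega> = complex_of_real (indicator {U1..t} s * (w \<xi> / (2 * pi))) * complex_of_real (J n s \<omega>) *
            (cis (- \<xi> * z) * cis (A \<omega> + \<xi> * Y s \<omega>))"
          by (simp add: F_def mult_ac)
        also have "cis (- \<xi> * z) * cis (A \<omega> + \<xi> * Y s \<omega>) = cis (A \<omega>) * cis (\<xi> * (Y s \<omega> - z))"
          by (simp add: cis_mult algebra_simps)
        finally show ?thesis by simp
      qed
      then show "(\<integral>\<xi>. F (s, \<xi>) \<omega> \<partial>lborel) = cis (A \<omega>) * complex_of_real (indicator {U1..t} s *\<^sub>R (f (Y s \<omega>) * J n s \<omega>))"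
        by (simp add: fourier)
    qed
    also have "\<dots> = cis (A \<omega>) * complex_of_real (J (Suc n) t \<omega>)"
      unfolding J_Suc[OF \<omega> t(1)] set_lebesgue_integral_def by (simp only: integral_mult_right_zero integral_complex_of_real)
    finally show ?thesis .
  qed
  have "(\<integral>\<omega>. cis (A \<omega>) * complex_of_real (J (Suc n) t \<omega>) \<partial>M) = (\<integral>\<omega>. (\<integral>p. F p \<omega> \<partial>lborel) \<partial>M)"
  proof (rule integral_cong_AE)
    show "AE \<omega> in M. cis (A \<omega>) * complex_of_real (J (Suc n) t \<omega>) = (\<integral>p. F p \<omega> \<partial>lborel)"
      using P.AE_integrable_snd[OF int] AE_space by eventually_elim (simp add: inner)
  qed auto
  also have "\<dots> = (\<integral>p. (\<integral>\<omega>. F p \<omega> \<partial>M) \<partial>lborel)"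
    by (rule P.Fubini_integral[OF int])
  also have "ennreal (norm \<dots>) \<le> (\<integral>\<^sup>+ p. ennreal (norm (\<integral>\<omega>. F p \<omega> \<partial>M)) \<partial>lborel)"
    by (intro integral_norm_bound_ennreal P.integrable_fst[OF int])
  also have "\<dots> = (\<integral>\<^sup>+ p. indicator {U1..t} (fst p) * (ennreal (\<bar>w (snd p)\<bar> / (2 * pi)) *
      ennreal (norm (\<integral>\<omega>. cis (A \<omega> + snd p * Y (fst p) \<omega>) * complex_of_real (J n (fst p) \<omega>) \<partial>M))) \<partial>(lborel \<Otimes>\<^sub>M lborel))"
    unfolding lborel_prod F_def integral_mult_right_zero
    by (intro nn_integral_cong) (simp add: norm_mult norm_divide ennreal_mult'[symmetric] indicator_def)
  also have "\<dots> = (\<integral>\<^sup>+ s. (\<integral>\<^sup>+ \<xi>. indicator {U1..t} s * (ennreal (\<bar>w \<xi>\<bar> / (2 * pi)) *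
      ennreal (norm (\<integral>\<omega>. cis (A \<omega> + \<xi> * Y s \<omega>) * complex_of_real (J n s \<omega>) \<partial>M))) \<partial>lborel) \<partial>lborel)"
    by (subst lborel.nn_integral_fst[symmetric]) auto
  also have "\<dots> = (\<integral>\<^sup>+ s \<in> {U1..t}. (\<integral>\<^sup>+ \<xi>. ennreal (\<bar>w \<xi>\<bar> / (2 * pi)) *
          ennreal (norm (\<integral>\<omega>. cis (A \<omega> + \<xi> * Y s \<omega>) * complex_of_real (J n s \<omega>) \<partial>M)) \<partial>lborel) \<partial>lborel)"
    by (intro nn_integral_cong) (simp add: nn_integral_cmult mult.commute)
  finally show ?thesis .
qed

text \<open>
  The exponent is a sum of frequencies times values of \<open>Y\<close> at the decreasing times \<open>t 0, \<dots>, t k\<close>,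
  rearranged by summation by parts: \<open>\<xi>\<close> is the sum of all frequencies and \<open>\<mu> j\<close> the sum of
  those at \<open>t 0, \<dots>, t j\<close>. A new time \<open>s \<le> t k\<close> of frequency \<open>\<eta>\<close> turns \<open>\<xi>\<close> into
  \<open>\<mu> k\<close> and \<open>\<xi> + \<eta>\<close> into the new sum.
\<close>

lemma expectation_J_le:
  assumes "\<And>j. j < k \<Longrightarrow> t (Suc j) \<le> t j" "t 0 \<le> U2" "U1 \<le> t k"
  shows "ennreal (norm (\<integral>\<omega>. cis (H k \<mu> t \<omega> + \<xi> * Y (t k) \<omega>) * complex_of_real (J n (t k) \<omega>) \<partial>M))
    \<le> lt_bound c U1 n \<xi> (t k) * ennreal (exp (- (c / 2) * (\<Sum>j<k. (\<mu> j)\<^sup>2 * (t j - t (Suc j)))))"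
  using assms
proof (induction n arbitrary: k t \<mu> \<xi>)
  case 0
  \<comment> \<open>With no time left, \<open>\<xi> * Y (t k)\<close> is itself a weighted
    increment, from \<open>U1\<close> to \<open>t k\<close>; appending \<open>U1\<close> as last
    time makes the whole exponent a combination of increments.\<close>
  define t' \<mu>' where "t' = t(Suc k := U1)" and "\<mu>' = \<mu>(k := \<xi>)"
  have H': "H (Suc k) \<mu>' t' \<omega> = H k \<mu> t \<omega> + \<xi> * Y (t k) \<omega>" for \<omega>
    by (simp add: H_def t'_def \<mu>'_def Y_def)
  have sum': "(\<Sum>j<Suc k. (\<mu>' j)\<^sup>2 * (t' j - t' (Suc j))) = (\<Sum>j<k. (\<mu> j)\<^sup>2 * (t j - t (Suc j))) + \<xi>\<^sup>2 * (t k - U1)"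
    by (simp add: t'_def \<mu>'_def)
  have "norm (\<integral>\<omega>. cis (H (Suc k) \<mu>' t' \<omega>) \<partial>M)
     \<le> exp (- (c / 2) * (\<Sum>j<Suc k. (\<mu>' j)\<^sup>2 * (t' j - t' (Suc j))))"
    by (rule expectation_cis_H_le) (use 0 in \<open>auto simp: t'_def less_Suc_eq\<close>)
  then show ?case
    unfolding H' sum' lt_bound.simps
    by (simp add: ennreal_mult[symmetric] exp_add[symmetric] algebra_simps)
next
  case (Suc n)
  define E where "E = exp (- (c / 2) * (\<Sum>j<k. (\<mu> j)\<^sup>2 * (t j - t (Suc j))))"
  have tk: "U1 \<le> t k" "t k \<le> U2"
    using Suc.prems antitone_upto[of k t 0 k] by force+
  have "ennreal (norm (\<integral>\<omega>. cis (H k \<mu> t \<omega> + \<xi> * Y (t k) \<omega>) * complex_of_real (J (Suc n) (t k) \<omega>) \<partial>M))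
    \<le> (\<integral>\<^sup>+ s \<in> {U1..t k}. (\<integral>\<^sup>+ \<eta>. ennreal (\<bar>w \<eta>\<bar> / (2 * pi)) *
          ennreal (norm (\<integral>\<omega>. cis (H k \<mu> t \<omega> + \<xi> * Y (t k) \<omega> + \<eta> * Y s \<omega>) * complex_of_real (J n s \<omega>) \<partial>M)) \<partial>lborel) \<partial>lborel)"
    by (rule expectation_J_Suc_le[OF _ tk]) measurable
  also have "\<dots> \<le> (\<integral>\<^sup>+ s \<in> {U1..t k}. (\<integral>\<^sup>+ \<eta>. ennreal (1 / (2 * pi)) *
       (lt_bound c U1 n (\<xi> + 1 * \<eta>) s * ennreal (exp (- (c / 2) * (\<xi>\<^sup>2 * (t k - s))) * E)) \<partial>lborel) \<partial>lborel)"
  proof (intro nn_integral_mono)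
    fix s
    show "(\<integral>\<^sup>+ \<eta>. ennreal (\<bar>w \<eta>\<bar> / (2 * pi)) *
          ennreal (norm (\<integral>\<omega>. cis (H k \<mu> t \<omega> + \<xi> * Y (t k) \<omega> + \<eta> * Y s \<omega>) * complex_of_real (J n s \<omega>) \<partial>M)) \<partial>lborel) * indicator {U1..t k} s
       \<le> (\<integral>\<^sup>+ \<eta>. ennreal (1 / (2 * pi)) *
       (lt_bound c U1 n (\<xi> + 1 * \<eta>) s * ennreal (exp (- (c / 2) * (\<xi>\<^sup>2 * (t k - s))) * E)) \<partial>lborel) * indicator {U1..t k} s"
    proof (cases "s \<in> {U1..t k}")
      case True
      define t' \<mu>' where "t' = t(Suc k := s)" and "\<mu>' = \<mu>(k := \<xi>)"
      have t'k: "t' (Suc k) = s" by (simp add: t'_def)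
      have mono: "t' (Suc j) \<le> t' j" if "j < Suc k" for j
        using that True Suc.prems(1)[of j] by (cases "j = k") (auto simp: t'_def)
      have sum': "exp (- (c / 2) * (\<Sum>j<Suc k. (\<mu>' j)\<^sup>2 * (t' j - t' (Suc j)))) = exp (- (c / 2) * (\<xi>\<^sup>2 * (t k - s))) * E"
        by (simp add: t'_def \<mu>'_def E_def exp_add[symmetric] algebra_simps)
      have "ennreal (\<bar>w \<eta>\<bar> / (2 * pi)) *
          ennreal (norm (\<integral>\<omega>. cis (H k \<mu> t \<omega> + \<xi> * Y (t k) \<omega> + \<eta> * Y s \<omega>) * complex_of_real (J n s \<omega>) \<partial>M))
         \<le> ennreal (1 / (2 * pi)) *
       (lt_bound c U1 n (\<xi> + 1 * \<eta>) s * ennreal (exp (- (c / 2) * (\<xi>\<^sup>2 * (t k - s))) * E))" for \<eta>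
      proof (intro mult_mono)
        \<comment> \<open>For the times inside the recursion the weight is given up and replaced by
          its bound 1.\<close>
        show "ennreal (\<bar>w \<eta>\<bar> / (2 * pi)) \<le> ennreal (1 / (2 * pi))"
          using w_le[of \<eta>] by (intro ennreal_leI divide_right_mono) auto
        have H': "H (Suc k) \<mu>' t' \<omega> + (\<xi> + \<eta>) * Y s \<omega> = H k \<mu> t \<omega> + \<xi> * Y (t k) \<omega> + \<eta> * Y s \<omega>" for \<omega>
          by (simp add: H_def t'_def \<mu>'_def Y_def algebra_simps)
        show "ennreal (norm (\<integral>\<omega>. cis (H k \<mu> t \<omega> + \<xi> * Y (t k) \<omega> + \<eta> * Y s \<omega>) * complex_of_real (J n s \<omega>) \<partial>M))
          \<le> lt_bound c U1 n (\<xi> + 1 * \<eta>) s * ennreal (exp (- (c / 2) * (\<xi>\<^sup>2 * (t k - s))) * E)"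
          using Suc.IH[of "Suc k" t' \<mu>' "\<xi> + \<eta>", OF mono] Suc.prems True
          unfolding sum' t'k H' by (simp add: t'_def)
      qed auto
      then show ?thesis
        by (intro mult_right_mono nn_integral_mono) auto
    qed simp
  qed
  also have "\<dots> = (\<integral>\<^sup>+ s. (ennreal (exp (- (c / 2) * (\<xi>\<^sup>2 * (t k - s)))) *
      (\<integral>\<^sup>+ \<eta>. ennreal (1 / (2 * pi)) * lt_bound c U1 n \<eta> s \<partial>lborel) * indicator {U1..t k} s) * ennreal E \<partial>lborel)"
  proof (rule nn_integral_cong)
    fix s
    have "(\<integral>\<^sup>+ \<eta>. ennreal (1 / (2 * pi)) *
       (lt_bound c U1 n (\<xi> + 1 * \<eta>) s * ennreal (exp (- (c / 2) * (\<xi>\<^sup>2 * (t k - s))) * E)) \<partial>lborel)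
      = (\<integral>\<^sup>+ \<eta>. (ennreal (exp (- (c / 2) * (\<xi>\<^sup>2 * (t k - s)))) * ennreal E) *
          (ennreal (1 / (2 * pi)) * lt_bound c U1 n (\<xi> + 1 * \<eta>) s) \<partial>lborel)"
      by (simp add: E_def ennreal_mult' mult_ac)
    also have "\<dots> = (ennreal (exp (- (c / 2) * (\<xi>\<^sup>2 * (t k - s)))) * ennreal E) *
          (\<integral>\<^sup>+ \<eta>. ennreal (1 / (2 * pi)) * lt_bound c U1 n (\<xi> + 1 * \<eta>) s \<partial>lborel)"
      by (rule nn_integral_cmult) measurable
    \<comment> \<open>Translation invariance of Lebesgue measure removes \<open>\<xi>\<close>: the
      partial sum becomes the new integration variable and the gaps decouple. The form
      \<open>\<xi> + 1 * \<eta>\<close> is that of the affine substitution rule.\<close>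
    also have "(\<integral>\<^sup>+ \<eta>. ennreal (1 / (2 * pi)) * lt_bound c U1 n (\<xi> + 1 * \<eta>) s \<partial>lborel)
       = (\<integral>\<^sup>+ \<eta>. ennreal (1 / (2 * pi)) * lt_bound c U1 n \<eta> s \<partial>lborel)"
      using nn_integral_real_affine[of "\<lambda>\<eta>. ennreal (1 / (2 * pi)) * lt_bound c U1 n \<eta> s" 1 \<xi>] by simp
    finally show "(\<integral>\<^sup>+ \<eta>. ennreal (1 / (2 * pi)) *
       (lt_bound c U1 n (\<xi> + 1 * \<eta>) s * ennreal (exp (- (c / 2) * (\<xi>\<^sup>2 * (t k - s))) * E)) \<partial>lborel) * indicator {U1..t k} s
      = (ennreal (exp (- (c / 2) * (\<xi>\<^sup>2 * (t k - s)))) *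
      (\<integral>\<^sup>+ \<eta>. ennreal (1 / (2 * pi)) * lt_bound c U1 n \<eta> s \<partial>lborel) * indicator {U1..t k} s) * ennreal E"
      by (simp add: mult_ac)
  qed
  also have "\<dots> = lt_bound c U1 (Suc n) \<xi> (t k) * ennreal E"
    unfolding lt_bound.simps by (rule nn_integral_multc) measurable
  finally show ?case unfolding E_def .
qed

text \<open>The latest time is peeled off separately so that its weight \<open>w\<close> is
  retained; all further times are handled by the uniform bound. The factorial undoes the restriction
  to ordered times.\<close>

lemma expectation_power_le:
  "ennreal \<bar>\<integral>\<omega>. G U2 \<omega> ^ Suc n \<partial>M\<bar>
    \<le> ennreal (fact (Suc n)) * (\<integral>\<^sup>+ s \<in> {U1..U2}. (\<integral>\<^sup>+ \<xi>. ennreal (\<bar>w \<xi>\<bar> / (2 * pi)) * lt_bound c U1 n \<xi> s \<partial>lborel) \<partial>lborel)"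
proof -
  have "ennreal (norm (\<integral>\<omega>. cis 0 * complex_of_real (J (Suc n) U2 \<omega>) \<partial>M))
    \<le> (\<integral>\<^sup>+ s \<in> {U1..U2}. (\<integral>\<^sup>+ \<xi>. ennreal (\<bar>w \<xi>\<bar> / (2 * pi)) *
          ennreal (norm (\<integral>\<omega>. cis (0 + \<xi> * Y s \<omega>) * complex_of_real (J n s \<omega>) \<partial>M)) \<partial>lborel) \<partial>lborel)"
    by (rule expectation_J_Suc_le) (use U in auto)
  also have "\<dots> \<le> (\<integral>\<^sup>+ s \<in> {U1..U2}. (\<integral>\<^sup>+ \<xi>. ennreal (\<bar>w \<xi>\<bar> / (2 * pi)) * lt_bound c U1 n \<xi> s \<partial>lborel) \<partial>lborel)"
  proof (intro nn_integral_mono)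
    fix s
    have "ennreal (norm (\<integral>\<omega>. cis (0 + \<xi> * Y s \<omega>) * complex_of_real (J n s \<omega>) \<partial>M)) \<le> lt_bound c U1 n \<xi> s"
      if "s \<in> {U1..U2}" for \<xi>
      \<comment> \<open>With \<open>k = 0\<close> there are no earlier increments: the sum in
        \<open>H\<close> and the one in the exponent are empty, and any weights will do.\<close>
      using expectation_J_le[of 0 "\<lambda>_. s" undefined \<xi> n] that by (simp add: H_def)
    then show "(\<integral>\<^sup>+ \<xi>. ennreal (\<bar>w \<xi>\<bar> / (2 * pi)) *
          ennreal (norm (\<integral>\<omega>. cis (0 + \<xi> * Y s \<omega>) * complex_of_real (J n s \<omega>) \<partial>M)) \<partial>lborel) * indicator {U1..U2} s
       \<le> (\<integral>\<^sup>+ \<xi>. ennreal (\<bar>w \<xi>\<bar> / (2 * pi)) * lt_bound c U1 n \<xi> s \<partial>lborel) * indicator {U1..U2} s"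
      by (auto simp: indicator_def intro!: nn_integral_mono mult_left_mono)
  qed
  also have "ennreal (norm (\<integral>\<omega>. cis 0 * complex_of_real (J (Suc n) U2 \<omega>) \<partial>M)) = ennreal (\<bar>\<integral>\<omega>. G U2 \<omega> ^ Suc n \<partial>M\<bar> / fact (Suc n))"
    by (simp only: J_def cis_zero mult_1 integral_complex_of_real norm_of_real integral_divide_zero abs_divide abs_of_nonneg fact_ge_zero)
  finally show ?thesis
    using ennreal_mult'[of "fact (Suc n)" "\<bar>\<integral>\<omega>. G U2 \<omega> ^ Suc n \<partial>M\<bar> / fact (Suc n)"]
    by (simp del: fact_Suc add: mult_left_mono)
qed

end

section \<open>Convergence of the smoothed local times\<close>

lemma (in prob_space) square_expectation_le:
  assumes "integrable M f" "integrable M (\<lambda>\<omega>. (f \<omega>)\<^sup>2)"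
  shows "(expectation f :: real)\<^sup>2 \<le> expectation (\<lambda>\<omega>. (f \<omega>)\<^sup>2)"
  using variance_eq[OF assms] variance_positive[of f] by simp

text \<open>Second moments make a sequence of parameters Cauchy in \<open>L_1\<close>, which yields
  a limit \<open>L\<close> along an almost surely convergent subsequence. Fatou transfers the bound
  on moments of order \<open>2 * p\<close> to \<open>Z \<epsilon> - L\<close> for every parameter,
  and Cauchy-Schwarz descends to order \<open>p\<close>. The bounds are extended reals because their
  finiteness is known only near 0, from the convergence.\<close>

lemma (in prob_space) has_Lp_limit_of_Cauchy:
  fixes Z :: "real \<Rightarrow> 'a \<Rightarrow> real" and a b :: "real \<Rightarrow> ennreal"
  assumes Z [measurable]: "\<And>\<epsilon>. \<epsilon> > 0 \<Longrightarrow> Z \<epsilon> \<in> borel_measurable M"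
    and bounded: "\<And>\<epsilon>. \<epsilon> > 0 \<Longrightarrow> \<exists>C. \<forall>\<omega>\<in>space M. \<bar>Z \<epsilon> \<omega>\<bar> \<le> C"
    and a: "\<And>\<epsilon> \<delta>. \<epsilon> > 0 \<Longrightarrow> \<delta> > 0 \<Longrightarrow> ennreal (\<integral>\<omega>. (Z \<epsilon> \<omega> - Z \<delta> \<omega>)\<^sup>2 \<partial>M) \<le> a \<epsilon> + a \<delta>"
    and b: "\<And>\<epsilon> \<delta>. \<epsilon> > 0 \<Longrightarrow> \<delta> > 0 \<Longrightarrow> ennreal (\<integral>\<omega>. (Z \<epsilon> \<omega> - Z \<delta> \<omega>) ^ (2 * p) \<partial>M) \<le> b \<epsilon> + b \<delta>"
    and a0: "(a \<longlongrightarrow> 0) (at_right 0)" and b0: "(b \<longlongrightarrow> 0) (at_right 0)"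
    and p: "p \<ge> 1"
  shows "\<exists>L. has_Lp_limit M p Z L (at_right 0)"
proof -
  have int: "integrable M (\<lambda>\<omega>. g (Z \<epsilon> \<omega>) (Z \<delta> \<omega>))"
    if pos: "\<epsilon> > 0" "\<delta> > 0" and g: "continuous_on UNIV (\<lambda>(u, v). g u v)" for \<epsilon> \<delta> and g :: "real \<Rightarrow> real \<Rightarrow> real"
  proof -
    obtain C D where C: "\<And>\<omega>. \<omega> \<in> space M \<Longrightarrow> \<bar>Z \<epsilon> \<omega>\<bar> \<le> C" and D: "\<And>\<omega>. \<omega> \<in> space M \<Longrightarrow> \<bar>Z \<delta> \<omega>\<bar> \<le> D"
      using bounded[OF pos(1)] bounded[OF pos(2)] by blast
    have "compact ((\<lambda>(u, v). g u v) ` ({- C..C} \<times> {- D..D}))"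
      by (intro compact_continuous_image continuous_on_subset[OF g] compact_Times) auto
    then have "bounded ((\<lambda>(u, v). g u v) ` ({- C..C} \<times> {- D..D}))"
      by (rule compact_imp_bounded)
    then obtain K where K: "\<And>u v. u \<in> {- C..C} \<Longrightarrow> v \<in> {- D..D} \<Longrightarrow> norm (g u v) \<le> K"
      unfolding bounded_iff by force
    have "(\<lambda>\<omega>. (\<lambda>(u, v). g u v) (Z \<epsilon> \<omega>, Z \<delta> \<omega>)) \<in> borel_measurable M"
      using Z[OF pos(1)] Z[OF pos(2)] by (intro borel_measurable_continuous_on[OF g] borel_measurable_Pair)
    moreover have "norm (g (Z \<epsilon> \<omega>) (Z \<delta> \<omega>)) \<le> K" if "\<omega> \<in> space M" for \<omega>
      using C[OF that] D[OF that] by (intro K) auto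
    ultimately show ?thesis
      by (intro integrable_const_bound[of _ K] AE_I2) auto
  qed
  define e where "e k = 1 / real (Suc k)" for k
  define s where "s k = Z (e k)" for k
  have e_pos: "e k > 0" for k by (simp add: e_def)
  have s [measurable]: "s k \<in> borel_measurable M" for k
    unfolding s_def by (rule Z[OF e_pos])
  have e_lim: "filterlim e (at_right 0) sequentially"
    unfolding filterlim_at using LIMSEQ_Suc[OF lim_1_over_n]
    by (auto simp: e_def[abs_def])
  have ae: "(\<lambda>k. a (e k)) \<longlonglongrightarrow> 0" and be: "(\<lambda>k. b (e k)) \<longlonglongrightarrow> 0"
    using filterlim_compose[OF a0 e_lim] filterlim_compose[OF b0 e_lim] .
  have s_int: "integrable M (s k)" for k
    unfolding s_def using int[OF e_pos e_pos, of "\<lambda>u v. u" k k] by (simp add: case_prod_unfold continuous_on_fst)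
  have "\<exists>N. \<forall>i\<ge>N. \<forall>j\<ge>N. (\<integral>\<omega>. norm (s i \<omega> - s j \<omega>) \<partial>M) < r" if r: "r > 0" for r
  proof -
    \<comment> \<open>Two such errors add up to less than the square of \<open>r\<close>, and
      Cauchy-Schwarz turns this into a first moment below \<open>r\<close>.\<close>
    have "eventually (\<lambda>k. a (e k) < ennreal (r\<^sup>2 / 2)) sequentially"
      using r by (intro order_tendstoD(2)[OF ae]) simp
    then obtain N where N: "\<And>k. k \<ge> N \<Longrightarrow> a (e k) < ennreal (r\<^sup>2 / 2)"
      by (auto simp: eventually_sequentially)
    have "(\<integral>\<omega>. norm (s i \<omega> - s j \<omega>) \<partial>M) < r" if "i \<ge> N" "j \<ge> N" for i j
    proof -
      have "ennreal (\<integral>\<omega>. (s i \<omega> - s j \<omega>)\<^sup>2 \<partial>M) \<le> a (e i) + a (e j)"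
        unfolding s_def by (rule a[OF e_pos e_pos])
      also have "\<dots> < ennreal (r\<^sup>2 / 2) + ennreal (r\<^sup>2 / 2)"
        by (intro add_strict_mono N that)
      also have "\<dots> = ennreal (r\<^sup>2)"
        by (simp add: ennreal_plus[symmetric] del: ennreal_plus)
      finally have "(\<integral>\<omega>. (s i \<omega> - s j \<omega>)\<^sup>2 \<partial>M) < r\<^sup>2"
        by (subst (asm) ennreal_less_iff) auto
      moreover have "(\<integral>\<omega>. \<bar>s i \<omega> - s j \<omega>\<bar> \<partial>M)\<^sup>2 \<le> (\<integral>\<omega>. \<bar>s i \<omega> - s j \<omega>\<bar>\<^sup>2 \<partial>M)"
        unfolding s_def
        by (intro square_expectation_le int[OF e_pos e_pos, of "\<lambda>u v. \<bar>u - v\<bar>"] int[OF e_pos e_pos, of "\<lambda>u v. \<bar>u - v\<bar>\<^sup>2"])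
          (auto simp: case_prod_unfold intro!: continuous_intros)
      ultimately show ?thesis
        using r by (auto intro: power2_less_imp_less)
    qed
    then show ?thesis by blast
  qed
  from cauchy_L1_AE_cauchy_subseq[OF s_int this]
  obtain r where r: "strict_mono r" "AE \<omega> in M. Cauchy (\<lambda>i. s (r i) \<omega>)" by blast
  \<comment> \<open>On the null set where the subsequence diverges \<open>lim\<close> still has some
    value, so \<open>L\<close> is defined and measurable everywhere.\<close>
  define L where "L \<omega> = lim (\<lambda>i. s (r i) \<omega>)" for \<omega>
  have L [measurable]: "L \<in> borel_measurable M"
    unfolding L_def by measurable
  have L_lim: "AE \<omega> in M. (\<lambda>i. s (r i) \<omega>) \<longlonglongrightarrow> L \<omega>"
    using r(2) by eventually_elim (simp add: L_def Cauchy_convergent_iff convergent_LIMSEQ_iff)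
  have Fatou: "(\<integral>\<^sup>+ \<omega>. ennreal ((Z \<epsilon> \<omega> - L \<omega>) ^ (2 * p)) \<partial>M) \<le> b \<epsilon>" if \<epsilon>: "\<epsilon> > 0" for \<epsilon>
  proof -
    note [measurable] = Z[OF \<epsilon>]
    have "(\<integral>\<^sup>+ \<omega>. ennreal ((Z \<epsilon> \<omega> - L \<omega>) ^ (2 * p)) \<partial>M)
       = (\<integral>\<^sup>+ \<omega>. liminf (\<lambda>i. ennreal ((Z \<epsilon> \<omega> - s (r i) \<omega>) ^ (2 * p))) \<partial>M)"
    proof (rule nn_integral_cong_AE)
      show "AE \<omega> in M. ennreal ((Z \<epsilon> \<omega> - L \<omega>) ^ (2 * p)) = liminf (\<lambda>i. ennreal ((Z \<epsilon> \<omega> - s (r i) \<omega>) ^ (2 * p)))"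
        using L_lim
      proof eventually_elim
        case (elim \<omega>)
        have "(\<lambda>i. ennreal ((Z \<epsilon> \<omega> - s (r i) \<omega>) ^ (2 * p))) \<longlonglongrightarrow> ennreal ((Z \<epsilon> \<omega> - L \<omega>) ^ (2 * p))"
          by (intro tendsto_ennrealI tendsto_intros elim)
        then show ?case by (rule lim_imp_Liminf[OF sequentially_bot, symmetric])
      qed
    qed
    also have "\<dots> \<le> liminf (\<lambda>i. \<integral>\<^sup>+ \<omega>. ennreal ((Z \<epsilon> \<omega> - s (r i) \<omega>) ^ (2 * p)) \<partial>M)"
      by (rule nn_integral_liminf) measurable
    also have "\<dots> \<le> liminf (\<lambda>i. b \<epsilon> + b (e (r i)))"
    proof (intro Liminf_mono always_eventually allI)
      fix i
      have "(\<integral>\<^sup>+ \<omega>. ennreal ((Z \<epsilon> \<omega> - s (r i) \<omega>) ^ (2 * p)) \<partial>M) = ennreal (\<integral>\<omega>. (Z \<epsilon> \<omega> - s (r i) \<omega>) ^ (2 * p) \<partial>M)"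
        unfolding s_def
        by (intro nn_integral_eq_integral int[OF \<epsilon> e_pos, of "\<lambda>u v. (u - v) ^ (2 * p)"])
          (auto simp: case_prod_unfold intro!: continuous_intros)
      also have "\<dots> \<le> b \<epsilon> + b (e (r i))"
        unfolding s_def by (rule b[OF \<epsilon> e_pos])
      finally show "(\<integral>\<^sup>+ \<omega>. ennreal ((Z \<epsilon> \<omega> - s (r i) \<omega>) ^ (2 * p)) \<partial>M) \<le> b \<epsilon> + b (e (r i))" .
    qed
    also have "liminf (\<lambda>i. b \<epsilon> + b (e (r i))) = b \<epsilon> + 0"
      using LIMSEQ_subseq_LIMSEQ[OF be r(1)]
      by (intro lim_imp_Liminf sequentially_bot tendsto_add tendsto_const) (simp add: o_def)
    finally show ?thesis by simp
  qed
  have D_int: "integrable M (\<lambda>\<omega>. (Z \<epsilon> \<omega> - L \<omega>) ^ (2 * p))" "integrable M (\<lambda>\<omega>. \<bar>Z \<epsilon> \<omega> - L \<omega>\<bar> ^ p)"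
    if \<epsilon>: "\<epsilon> > 0" and b_fin: "b \<epsilon> < \<infinity>" for \<epsilon>
  proof -
    note [measurable] = Z[OF \<epsilon>]
    show 1: "integrable M (\<lambda>\<omega>. (Z \<epsilon> \<omega> - L \<omega>) ^ (2 * p))"
      using le_less_trans[OF Fatou[OF \<epsilon>] b_fin] by (intro integrableI_bounded) auto
    show "integrable M (\<lambda>\<omega>. \<bar>Z \<epsilon> \<omega> - L \<omega>\<bar> ^ p)"
    proof (rule Bochner_Integration.integrable_bound[where f="\<lambda>\<omega>. 1 + (Z \<epsilon> \<omega> - L \<omega>) ^ (2 * p)"])
      have "\<bar>y\<bar> ^ p \<le> 1 + y ^ (2 * p)" for y :: real
      proof -
        have "y ^ (2 * p) = (\<bar>y\<bar> ^ p)\<^sup>2"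
          by (simp add: power_mult[symmetric] power_even_abs mult.commute[of p 2])
        moreover have "0 \<le> \<bar>y\<bar> ^ p"
          by simp
        moreover have "2 * \<bar>y\<bar> ^ p \<le> 1 + (\<bar>y\<bar> ^ p)\<^sup>2"
          using zero_le_power2[of "\<bar>y\<bar> ^ p - 1"] by (simp add: power2_diff)
        ultimately show ?thesis by linarith
      qed
      then show "AE \<omega> in M. norm (\<bar>Z \<epsilon> \<omega> - L \<omega>\<bar> ^ p) \<le> norm (1 + (Z \<epsilon> \<omega> - L \<omega>) ^ (2 * p))"
        by (intro AE_I2) (simp add: abs_of_nonneg[OF add_nonneg_nonneg])
    qed (use 1 in auto)
  qed
  have ev: "eventually (\<lambda>\<epsilon>. \<epsilon> > 0 \<and> b \<epsilon> < \<infinity>) (at_right 0)"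
    using eventually_at_right_less[of "0 :: real"] order_tendstoD(2)[OF b0, of "\<infinity>"] by (auto intro: eventually_conj)
  have "in_Lp M p L"
  proof -
    \<comment> \<open>A single parameter with finite error is enough: \<open>Z \<epsilon>\<close> is
      bounded and \<open>Z \<epsilon> - L\<close> is in \<open>L_p\<close>.\<close>
    obtain \<epsilon> where \<epsilon>: "\<epsilon> > 0" "b \<epsilon> < \<infinity>"
      using eventually_happens'[OF _ ev] by (auto simp: trivial_limit_at_right_real)
    obtain C where C: "\<And>\<omega>. \<omega> \<in> space M \<Longrightarrow> \<bar>Z \<epsilon> \<omega>\<bar> \<le> C"
      using bounded[OF \<epsilon>(1)] by blast
    have "integrable M (\<lambda>\<omega>. \<bar>L \<omega>\<bar> ^ p)"
    proof (rule Bochner_Integration.integrable_bound)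
      show "integrable M (\<lambda>\<omega>. 2 ^ p * (\<bar>Z \<epsilon> \<omega> - L \<omega>\<bar> ^ p + \<bar>C\<bar> ^ p))"
        using D_int(2)[OF \<epsilon>] by auto
      show "AE \<omega> in M. norm (\<bar>L \<omega>\<bar> ^ p) \<le> norm (2 ^ p * (\<bar>Z \<epsilon> \<omega> - L \<omega>\<bar> ^ p + \<bar>C\<bar> ^ p))"
      proof (rule AE_I2)
        fix \<omega> assume "\<omega> \<in> space M"
        then have "\<bar>Z \<epsilon> \<omega>\<bar> \<le> max \<bar>Z \<epsilon> \<omega> - L \<omega>\<bar> \<bar>C\<bar>"
          using C[of \<omega>] abs_ge_self[of C] by (intro max.coboundedI2) linarith
        moreover have "\<bar>Z \<epsilon> \<omega> - L \<omega>\<bar> \<le> max \<bar>Z \<epsilon> \<omega> - L \<omega>\<bar> \<bar>C\<bar>"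
          by (rule max.cobounded1)
        moreover have "\<bar>L \<omega>\<bar> \<le> \<bar>Z \<epsilon> \<omega>\<bar> + \<bar>Z \<epsilon> \<omega> - L \<omega>\<bar>"
          using abs_triangle_ineq4[of "Z \<epsilon> \<omega>" "Z \<epsilon> \<omega> - L \<omega>"] by simp
        ultimately have "\<bar>L \<omega>\<bar> \<le> 2 * max \<bar>Z \<epsilon> \<omega> - L \<omega>\<bar> \<bar>C\<bar>"
          unfolding mult_2 by (meson add_mono order_trans)
        then have "\<bar>L \<omega>\<bar> ^ p \<le> (2 * max \<bar>Z \<epsilon> \<omega> - L \<omega>\<bar> \<bar>C\<bar>) ^ p"
          by (intro power_mono) auto
        also have "\<dots> \<le> 2 ^ p * (\<bar>Z \<epsilon> \<omega> - L \<omega>\<bar> ^ p + \<bar>C\<bar> ^ p)"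
          by (auto simp: power_mult_distrib max_def)
        finally show "norm (\<bar>L \<omega>\<bar> ^ p) \<le> norm (2 ^ p * (\<bar>Z \<epsilon> \<omega> - L \<omega>\<bar> ^ p + \<bar>C\<bar> ^ p))"
          by simp
      qed
    qed measurable
    then show ?thesis by (simp add: in_Lp_def)
  qed
  moreover have "eventually (\<lambda>\<epsilon>. in_Lp M p (Z \<epsilon>)) (at_right 0)"
    using eventually_at_right_less
  proof eventually_elim
    case (elim \<epsilon>)
    have "continuous_on UNIV (\<lambda>(u, v :: real). \<bar>u :: real\<bar> ^ p)"
      unfolding case_prod_unfold by (intro continuous_intros)
    then show ?case
      using Z[OF elim] int[OF elim elim] by (simp add: in_Lp_def)
  qed
  moreover have "((\<lambda>\<epsilon>. Lp_norm M p (\<lambda>\<omega>. Z \<epsilon> \<omega> - L \<omega>)) \<longlongrightarrow> 0) (at_right 0)"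
  proof -
    define q where "q \<epsilon> = (\<integral>\<omega>. \<bar>Z \<epsilon> \<omega> - L \<omega>\<bar> ^ p \<partial>M)" for \<epsilon>
    have q: "q \<epsilon> \<ge> 0" for \<epsilon> unfolding q_def by simp
    have "((\<lambda>\<epsilon>. ennreal ((q \<epsilon>)\<^sup>2)) \<longlongrightarrow> 0) (at_right 0)"
    proof (rule tendsto_sandwich[OF _ _ tendsto_const b0])
      show "eventually (\<lambda>\<epsilon>. ennreal ((q \<epsilon>)\<^sup>2) \<le> b \<epsilon>) (at_right 0)"
        using ev
      proof eventually_elim
        case (elim \<epsilon>)
        then have \<epsilon>: "\<epsilon> > 0" "b \<epsilon> < \<infinity>" by auto
        have e: "(\<bar>y\<bar> ^ p)\<^sup>2 = y ^ (2 * p)" for y :: real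
          by (simp add: power_mult[symmetric] power_even_abs mult.commute[of p 2])
        have "(q \<epsilon>)\<^sup>2 \<le> (\<integral>\<omega>. (Z \<epsilon> \<omega> - L \<omega>) ^ (2 * p) \<partial>M)"
          using square_expectation_le[OF D_int(2)[OF \<epsilon>]] D_int(1)[OF \<epsilon>] by (simp add: q_def e)
        then have "ennreal ((q \<epsilon>)\<^sup>2) \<le> ennreal (\<integral>\<omega>. (Z \<epsilon> \<omega> - L \<omega>) ^ (2 * p) \<partial>M)"
          by (rule ennreal_leI)
        also have "\<dots> = (\<integral>\<^sup>+ \<omega>. ennreal ((Z \<epsilon> \<omega> - L \<omega>) ^ (2 * p)) \<partial>M)"
          by (rule nn_integral_eq_integral[symmetric, OF D_int(1)[OF \<epsilon>]]) auto
        finally show ?case using Fatou[OF \<epsilon>(1)] by (rule order_trans)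
      qed
    qed auto
    then have "((\<lambda>\<epsilon>. (q \<epsilon>)\<^sup>2) \<longlongrightarrow> 0) (at_right 0)"
      using tendsto_ennreal_iff[of "\<lambda>\<epsilon>. (q \<epsilon>)\<^sup>2" "at_right 0" 0] by simp
    then have "((\<lambda>\<epsilon>. root p (sqrt ((q \<epsilon>)\<^sup>2))) \<longlongrightarrow> root p (sqrt 0)) (at_right 0)"
      by (intro tendsto_real_root tendsto_real_sqrt)
    then show ?thesis
      unfolding Lp_norm_def q_def[symmetric] using q by simp
  qed
  ultimately show ?thesis
    unfolding has_Lp_limit_def by blast
qed

text \<open>The weight is the distance, in frequency space, of the heat kernel from a point mass.
  The weight of a difference of two kernels is at most the sum of two such distances, so a Cauchy
  estimate splits into one error per parameter. The index \<open>n\<close> belongs to the moment of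
  order \<open>Suc n\<close>.\<close>

definition (in heat_solution) smoothing_error :: "nat \<Rightarrow> real \<Rightarrow> ennreal" where
  "smoothing_error n \<epsilon> = ennreal (fact (Suc n)) * (\<integral>\<^sup>+ s \<in> {U1..U2}. (\<integral>\<^sup>+ \<xi>.
      ennreal ((1 - exp (- \<epsilon> * \<xi>\<^sup>2 / 2)) / (2 * pi)) * lt_bound c U1 n \<xi> s \<partial>lborel) \<partial>lborel)"

context heat_solution
begin

lemma smoothing_error_tendsto: "(smoothing_error n \<longlongrightarrow> 0) (at_right 0)"
proof -
  define v where "v \<epsilon> p = ennreal ((1 - exp (- \<epsilon> * (fst p)\<^sup>2 / 2)) / (2 * pi)) * (lt_bound c U1 n (fst p) (snd p) * indicator {U1..U2} (snd p))"
    for \<epsilon> and p :: "real \<times> real"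
  have iterated: "(\<integral>\<^sup>+ s \<in> {U1..U2}. (\<integral>\<^sup>+ \<xi>. g \<xi> * lt_bound c U1 n \<xi> s \<partial>lborel) \<partial>lborel)
     = (\<integral>\<^sup>+ p. g (fst p) * (lt_bound c U1 n (fst p) (snd p) * indicator {U1..U2} (snd p)) \<partial>(lborel \<Otimes>\<^sub>M lborel))"
    if [measurable]: "g \<in> borel_measurable borel" for g :: "real \<Rightarrow> ennreal"
    by (subst lborel_pair.nn_integral_snd[symmetric])
      (auto simp: nn_integral_multc[symmetric] mult.assoc intro!: nn_integral_cong)
  have "((\<lambda>\<epsilon>. \<integral>\<^sup>+ p. v \<epsilon> p \<partial>(lborel \<Otimes>\<^sub>M lborel)) \<longlongrightarrow> 0) (at_right 0)"
  proof (rule tendsto_at_right_sequentially[of 0 1])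
    fix e :: "nat \<Rightarrow> real"
    assume e: "\<And>k. 0 < e k" "e \<longlonglongrightarrow> 0"
    have "(\<lambda>k. \<integral>\<^sup>+ p. v (e k) p \<partial>(lborel \<Otimes>\<^sub>M lborel)) \<longlonglongrightarrow> (\<integral>\<^sup>+ p. 0 \<partial>(lborel \<Otimes>\<^sub>M lborel :: (real \<times> real) measure))"
    proof (rule nn_integral_dominated_convergence)
      let ?w = "\<lambda>p. ennreal (1 / (2 * pi)) * (lt_bound c U1 n (fst p) (snd p) * indicator {U1..U2} (snd p))"
      show fin: "(\<integral>\<^sup>+ p. ?w p \<partial>(lborel \<Otimes>\<^sub>M lborel)) < \<infinity>"
        using nn_integral_lt_bound_finite[OF c_pos, of U1 n U2] by (subst (asm) iterated) auto
      show "AE p in lborel \<Otimes>\<^sub>M lborel. v (e k) p \<le> ?w p" for k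
        unfolding v_def by (intro AE_I2 mult_right_mono ennreal_leI divide_right_mono) auto
      \<comment> \<open>Where \<open>lt_bound\<close> is infinite the vanishing weight would not
        force convergence to 0; finiteness of the majorant's integral confines this to a null
        set.\<close>
      have "AE p in lborel \<Otimes>\<^sub>M lborel. ?w p \<noteq> \<infinity>"
        using fin by (intro nn_integral_noteq_infinite) auto
      then show "AE p in lborel \<Otimes>\<^sub>M lborel. (\<lambda>k. v (e k) p) \<longlonglongrightarrow> 0"
      proof eventually_elim
        case (elim p)
        have "(\<lambda>k. ennreal ((1 - exp (- e k * (fst p)\<^sup>2 / 2)) / (2 * pi))) \<longlonglongrightarrow> ennreal ((1 - exp (- 0 * (fst p)\<^sup>2 / 2)) / (2 * pi))"
          by (intro tendsto_ennrealI tendsto_intros e) auto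
        then have "(\<lambda>k. ennreal ((1 - exp (- e k * (fst p)\<^sup>2 / 2)) / (2 * pi)) * (lt_bound c U1 n (fst p) (snd p) * indicator {U1..U2} (snd p)))
           \<longlonglongrightarrow> ennreal ((1 - exp (- 0 * (fst p)\<^sup>2 / 2)) / (2 * pi)) * (lt_bound c U1 n (fst p) (snd p) * indicator {U1..U2} (snd p))"
          using elim by (intro tendsto_mult_ennreal tendsto_const) (auto simp: ennreal_mult_eq_top_iff)
        then show ?case by (simp add: v_def)
      qed
    qed (auto simp: v_def)
    then show "(\<lambda>k. \<integral>\<^sup>+ p. v (e k) p \<partial>(lborel \<Otimes>\<^sub>M lborel)) \<longlonglongrightarrow> 0" by simp
  qed simp
  then have "((\<lambda>\<epsilon>. ennreal (fact (Suc n)) * (\<integral>\<^sup>+ p. v \<epsilon> p \<partial>(lborel \<Otimes>\<^sub>M lborel))) \<longlongrightarrow> ennreal (fact (Suc n)) * 0) (at_right 0)"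
    by (intro tendsto_mult_ennreal tendsto_const) auto
  moreover have "smoothing_error n = (\<lambda>\<epsilon>. ennreal (fact (Suc n)) * (\<integral>\<^sup>+ p. v \<epsilon> p \<partial>(lborel \<Otimes>\<^sub>M lborel)))"
    unfolding smoothing_error_def v_def by (rule ext, subst iterated) auto
  ultimately show ?thesis by (simp only: mult_zero_right)
qed

section \<open>Smoothed local times and their Cauchy property\<close>

definition smoothed_lt :: "real \<Rightarrow> real \<Rightarrow> 'a \<Rightarrow> real" where
  "smoothed_lt z \<epsilon> \<omega> = (LINT s:{U1..U2}|lborel. heat_kernel \<epsilon> (Y s \<omega> - z))"

lemma borel_measurable_smoothed_lt: "smoothed_lt z \<epsilon> \<in> borel_measurable M"
  unfolding smoothed_lt_def[abs_def] set_lebesgue_integral_def by measurable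

lemma continuous_on_heat_kernel_Y: "\<omega> \<in> space M \<Longrightarrow> continuous_on S (\<lambda>s. heat_kernel \<epsilon> (Y s \<omega> - z))"
  unfolding Y_def by (intro continuous_intros continuous_X)

lemma smoothed_lt_bounded:
  assumes \<epsilon>: "\<epsilon> > 0"
  shows "\<exists>C. \<forall>\<omega>\<in>space M. \<bar>smoothed_lt z \<epsilon> \<omega>\<bar> \<le> C"
proof (intro exI ballI)
  fix \<omega> assume \<omega>: "\<omega> \<in> space M"
  have "smoothed_lt z \<epsilon> \<omega> = integral {U1..U2} (\<lambda>s. heat_kernel \<epsilon> (Y s \<omega> - z))"
    unfolding smoothed_lt_def
    by (intro set_borel_integral_eq_integral borel_integrable_atLeastAtMost' continuous_on_heat_kernel_Y \<omega>)
  also have "\<bar>\<dots>\<bar> \<le> 1 / sqrt (2 * pi * \<epsilon>) * (U2 - U1)"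
    using integral_bound[of U1 U2 "\<lambda>s. heat_kernel \<epsilon> (Y s \<omega> - z)" "1 / sqrt (2 * pi * \<epsilon>)"]
      U \<epsilon> heat_kernel_le continuous_on_heat_kernel_Y[OF \<omega>] by simp
  finally show "\<bar>smoothed_lt z \<epsilon> \<omega>\<bar> \<le> 1 / sqrt (2 * pi * \<epsilon>) * (U2 - U1)" .
qed

lemma smoothed_lt_Cauchy:
  assumes \<epsilon>: "\<epsilon> > 0" and \<delta>: "\<delta> > 0"
  shows "ennreal \<bar>\<integral>\<omega>. (smoothed_lt z \<epsilon> \<omega> - smoothed_lt z \<delta> \<omega>) ^ Suc n \<partial>M\<bar> \<le> smoothing_error n \<epsilon> + smoothing_error n \<delta>"
proof -
  define f where "f y = heat_kernel \<epsilon> (y - z) - heat_kernel \<delta> (y - z)" for y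
  define w where "w \<xi> = exp (- \<epsilon> * \<xi>\<^sup>2 / 2) - exp (- \<delta> * \<xi>\<^sup>2 / 2)" for \<xi> :: real
  have w_diff_le: "\<bar>w \<xi>\<bar> \<le> (1 - exp (- \<epsilon> * \<xi>\<^sup>2 / 2)) + (1 - exp (- \<delta> * \<xi>\<^sup>2 / 2))" and w_le_1: "\<bar>w \<xi>\<bar> \<le> 1" for \<xi>
  proof -
    have "exp (- \<epsilon> * \<xi>\<^sup>2 / 2) \<le> 1" "exp (- \<delta> * \<xi>\<^sup>2 / 2) \<le> 1"
      using \<epsilon> \<delta> by auto
    then show "\<bar>w \<xi>\<bar> \<le> (1 - exp (- \<epsilon> * \<xi>\<^sup>2 / 2)) + (1 - exp (- \<delta> * \<xi>\<^sup>2 / 2))" "\<bar>w \<xi>\<bar> \<le> 1"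
      using exp_gt_zero[of "- \<epsilon> * \<xi>\<^sup>2 / 2"] exp_gt_zero[of "- \<delta> * \<xi>\<^sup>2 / 2"] unfolding w_def by linarith+
  qed
  interpret fourier_test M W x U1 U2 f w z "1 / sqrt (2 * pi * \<epsilon>) + 1 / sqrt (2 * pi * \<delta>)"
  proof
    have "integrable lborel (\<lambda>\<xi>. exp (- r * \<xi>\<^sup>2 / 2))" if "r > 0" for r :: real
      using integrable_norm[OF integrable_gaussian_cis[OF that, of 0]] by simp
    then show "integrable lborel w"
      unfolding w_def using \<epsilon> \<delta> by auto
    show "\<bar>w \<xi>\<bar> \<le> 1" for \<xi> by (rule w_le_1)
    show "(\<integral>\<xi>. complex_of_real (w \<xi>) * cis (\<xi> * (y - z)) \<partial>lborel) = complex_of_real (2 * pi * f y)" for y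
      unfolding w_def of_real_diff left_diff_distrib
      by (simp only: Bochner_Integration.integral_diff[OF integrable_gaussian_cis[OF \<epsilon>] integrable_gaussian_cis[OF \<delta>]]
          heat_kernel_fourier[OF \<epsilon>] heat_kernel_fourier[OF \<delta>]) (simp add: f_def right_diff_distrib)
    show "continuous_on UNIV f"
      unfolding f_def by (intro continuous_intros)
    show "\<bar>f y\<bar> \<le> 1 / sqrt (2 * pi * \<epsilon>) + 1 / sqrt (2 * pi * \<delta>)" for y
      using heat_kernel_le[OF \<epsilon>, of "y - z"] heat_kernel_le[OF \<delta>, of "y - z"]
        heat_kernel_nonneg[of \<epsilon> "y - z"] heat_kernel_nonneg[of \<delta> "y - z"] \<epsilon> \<delta>
      unfolding f_def by linarith
  qed
  \<comment> \<open>By linearity of the time integral, the moments of \<open>G\<close> bounded above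
    are those of the difference of two smoothed local times.\<close>
  have "G U2 \<omega> = smoothed_lt z \<epsilon> \<omega> - smoothed_lt z \<delta> \<omega>" if "\<omega> \<in> space M" for \<omega>
    unfolding G_def f_def smoothed_lt_def
    by (intro set_integral_diff borel_integrable_atLeastAtMost' continuous_on_heat_kernel_Y that)
  then have "ennreal \<bar>\<integral>\<omega>. (smoothed_lt z \<epsilon> \<omega> - smoothed_lt z \<delta> \<omega>) ^ Suc n \<partial>M\<bar> = ennreal \<bar>\<integral>\<omega>. G U2 \<omega> ^ Suc n \<partial>M\<bar>"
    by (simp cong: Bochner_Integration.integral_cong)
  also have "\<dots> \<le> ennreal (fact (Suc n)) * (\<integral>\<^sup>+ s \<in> {U1..U2}. (\<integral>\<^sup>+ \<xi>. ennreal (\<bar>w \<xi>\<bar> / (2 * pi)) * lt_bound c U1 n \<xi> s \<partial>lborel) \<partial>lborel)"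
    by (rule expectation_power_le)
  also have "\<dots> \<le> ennreal (fact (Suc n)) * (\<integral>\<^sup>+ s.
       (\<integral>\<^sup>+ \<xi>. ennreal ((1 - exp (- \<epsilon> * \<xi>\<^sup>2 / 2)) / (2 * pi)) * lt_bound c U1 n \<xi> s \<partial>lborel) * indicator {U1..U2} s
     + (\<integral>\<^sup>+ \<xi>. ennreal ((1 - exp (- \<delta> * \<xi>\<^sup>2 / 2)) / (2 * pi)) * lt_bound c U1 n \<xi> s \<partial>lborel) * indicator {U1..U2} s \<partial>lborel)"
  proof (intro mult_left_mono nn_integral_mono)
    fix s :: real
    have "(\<integral>\<^sup>+ \<xi>. ennreal (\<bar>w \<xi>\<bar> / (2 * pi)) * lt_bound c U1 n \<xi> s \<partial>lborel)
      \<le> (\<integral>\<^sup>+ \<xi>. ennreal ((1 - exp (- \<epsilon> * \<xi>\<^sup>2 / 2)) / (2 * pi)) * lt_bound c U1 n \<xi> s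
          + ennreal ((1 - exp (- \<delta> * \<xi>\<^sup>2 / 2)) / (2 * pi)) * lt_bound c U1 n \<xi> s \<partial>lborel)"
    proof (rule nn_integral_mono)
      fix \<xi> :: real
      have "ennreal (\<bar>w \<xi>\<bar> / (2 * pi)) \<le> ennreal ((1 - exp (- \<epsilon> * \<xi>\<^sup>2 / 2)) / (2 * pi) + (1 - exp (- \<delta> * \<xi>\<^sup>2 / 2)) / (2 * pi))"
        unfolding add_divide_distrib[symmetric] by (intro ennreal_leI divide_right_mono w_diff_le) auto
      also have "\<dots> = ennreal ((1 - exp (- \<epsilon> * \<xi>\<^sup>2 / 2)) / (2 * pi)) + ennreal ((1 - exp (- \<delta> * \<xi>\<^sup>2 / 2)) / (2 * pi))"
        using \<epsilon> \<delta> by (intro ennreal_plus) auto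
      finally show "ennreal (\<bar>w \<xi>\<bar> / (2 * pi)) * lt_bound c U1 n \<xi> s
         \<le> ennreal ((1 - exp (- \<epsilon> * \<xi>\<^sup>2 / 2)) / (2 * pi)) * lt_bound c U1 n \<xi> s
          + ennreal ((1 - exp (- \<delta> * \<xi>\<^sup>2 / 2)) / (2 * pi)) * lt_bound c U1 n \<xi> s"
        unfolding distrib_right[symmetric] by (intro mult_right_mono) auto
    qed
    also have "\<dots> = (\<integral>\<^sup>+ \<xi>. ennreal ((1 - exp (- \<epsilon> * \<xi>\<^sup>2 / 2)) / (2 * pi)) * lt_bound c U1 n \<xi> s \<partial>lborel)
          + (\<integral>\<^sup>+ \<xi>. ennreal ((1 - exp (- \<delta> * \<xi>\<^sup>2 / 2)) / (2 * pi)) * lt_bound c U1 n \<xi> s \<partial>lborel)"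
      by (rule nn_integral_add) measurable
    finally show "(\<integral>\<^sup>+ \<xi>. ennreal (\<bar>w \<xi>\<bar> / (2 * pi)) * lt_bound c U1 n \<xi> s \<partial>lborel) * indicator {U1..U2} s
      \<le> (\<integral>\<^sup>+ \<xi>. ennreal ((1 - exp (- \<epsilon> * \<xi>\<^sup>2 / 2)) / (2 * pi)) * lt_bound c U1 n \<xi> s \<partial>lborel) * indicator {U1..U2} s
     + (\<integral>\<^sup>+ \<xi>. ennreal ((1 - exp (- \<delta> * \<xi>\<^sup>2 / 2)) / (2 * pi)) * lt_bound c U1 n \<xi> s \<partial>lborel) * indicator {U1..U2} s"
      unfolding distrib_right[symmetric] by (intro mult_right_mono) auto
  qed auto
  also have "\<dots> = smoothing_error n \<epsilon> + smoothing_error n \<delta>"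
    unfolding smoothing_error_def distrib_left[symmetric]
    by (intro arg_cong2[where f="(*)"] refl nn_integral_add) measurable
  finally show ?thesis .
qed

lemma is_local_time_exists:
  assumes p: "p \<ge> 1"
  shows "\<exists>L. is_local_time M p (\<lambda>u \<omega>. x u \<omega> - x U1 \<omega>) U1 U2 z L"
proof -
  have e: "(\<lambda>\<epsilon> \<omega>. LINT s:{U1..U2}|lborel. heat_kernel \<epsilon> (x s \<omega> - x U1 \<omega> - z)) = smoothed_lt z"
    unfolding smoothed_lt_def[abs_def] set_lebesgue_integral_def Y_def using U
    by (intro ext Bochner_Integration.integral_cong) (auto simp: indicator_def X_eq)
  have nn: "\<bar>\<integral>\<omega>. (g \<omega>) ^ (2 * k) \<partial>M\<bar> = (\<integral>\<omega>. (g \<omega>) ^ (2 * k) \<partial>M)" for g :: "'a \<Rightarrow> real" and k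
    by (intro abs_of_nonneg integral_nonneg_AE) auto
  \<comment> \<open>The error of index \<open>m\<close> controls the moment of order
    \<open>Suc m\<close>; likewise index 1 is the one for second moments.\<close>
  obtain m where m: "2 * p = Suc m"
    using p by (cases "2 * p") auto
  show ?thesis
    unfolding is_local_time_def e
  proof (rule has_Lp_limit_of_Cauchy[OF _ _ _ _ smoothing_error_tendsto[of 1] smoothing_error_tendsto[of m] p])
    fix \<epsilon> \<delta> :: real assume "\<epsilon> > 0" "\<delta> > 0"
    note * = smoothed_lt_Cauchy[OF this, of z]
    show "ennreal (\<integral>\<omega>. (smoothed_lt z \<epsilon> \<omega> - smoothed_lt z \<delta> \<omega>)\<^sup>2 \<partial>M) \<le> smoothing_error 1 \<epsilon> + smoothing_error 1 \<delta>"
      using *[of 1] nn[of _ 1] by (simp add: numeral_2_eq_2)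
    show "ennreal (\<integral>\<omega>. (smoothed_lt z \<epsilon> \<omega> - smoothed_lt z \<delta> \<omega>) ^ (2 * p) \<partial>M) \<le> smoothing_error m \<epsilon> + smoothing_error m \<delta>"
      using *[of m] nn[of _ p] unfolding m by simp
  qed (auto intro: borel_measurable_smoothed_lt smoothed_lt_bounded)
qed

end

theorem theorem2p2:
  fixes M :: "'a measure"
    and W :: "(real \<times> real \<Rightarrow> real) \<Rightarrow> 'a \<Rightarrow> real"
    and x :: "real \<Rightarrow> 'a \<Rightarrow> real"
    and U1 U2 :: real
  assumes "prob_space M"
    and "U1 < U2"
    and "space_time_white_noise M W"
    and "heat_solution_version M W {U1..U2} x"
  shows "\<forall>p::nat. p \<ge> 1 \<longrightarrow>
    (\<forall>z::real. \<exists>L. is_local_time M p (\<lambda>u \<omega>. x u \<omega> - x U1 \<omega>) U1 U2 z L)"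
proof -
  interpret prob_space M by fact
  interpret heat_solution M W x U1 U2
    by unfold_locales fact+
  show ?thesis
    using is_local_time_exists by blast
qed

end
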